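(* Let $c>0$ and $\lambda>0$, and let $\cosh\eta_{cm}(t)$ be the random variable defined in the context from a homogeneous Poisson process of rate $\lambda$. Then for every $t>0$ $$E\{ \cosh \eta_{cm}(t)\}=\frac{2^3 c^2 e^{-\frac{3}{4}\lambda t}}{\sqrt{\lambda^2+16 c^2}} \left\{ \frac{e^{-\frac{t}{4} \sqrt{\lambda^2+16c^2}}}{3 \sqrt{\lambda^2+16c^2}+5 \lambda}+\frac{e^{\frac{t}{4}\sqrt{\lambda^2+16c^2}}}{3 \sqrt{\lambda^2+16c^2}-5 \lambda} \right\}+ \frac{\lambda+2c}{2(\lambda+3c)}e^{ct}+\frac{\lambda-2c}{2(\lambda-3c)}e^{-ct},$$ where for $\lambda=3c$ the right-hand side is understood as its (finite) limit as $\lambda\to 3c$.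
   Context: Let $N(t)$, $t\ge 0$, be a homogeneous Poisson process of rate $\lambda>0$ with successive event times $0<S_1<S_2<\cdots$, and set $S_0=0$. Let $c>0$ (the constant hyperbolic velocity). For $t>0$ and $0\le k\le N(t)$, define $\eta_k(t)\ge 0$ by $$\cosh\eta_k(t)=\cosh c(t-S_k)\prod_{j=1}^{k}\cosh c(S_j-S_{j-1})$$ (empty product equal to $1$); this is the hyperbolic distance from the origin of the $k$-th particle in a branching system in the hyperbolic plane, where at each Poisson event the last deviated particle splits into two halves, one continuing on its geodesic and the other deviating orthogonally to the geodesic joining its position with the origin. The particle $k<N(t)$ has mass $2^{-(k+1)}$ and the particle $k=N(t)$ has mass $2^{-N(t)}$. The hyperbolic distance $\eta_{cm}(t)\ge0$ of the center of mass is defined by $$\cosh\eta_{cm}(t)=\sum_{k=0}^{N(t)-1}\frac{1}{2^{k+1}}\cosh\eta_k(t)+\frac{1}{2^{N(t)}}\cosh\eta_{N(t)}(t),$$ where the first sum is $0$ if $N(t)=0$. *)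

theory Defs
  imports "HOL-Probability.Probability"
begin

text \<open>
  Only times \<open>t \<ge> 0\<close> are constrained. The increments are natural number differences, which do not
  truncate because the paths are nondecreasing.
\<close>
locale poisson_process = prob_space M for M :: "'a measure" +
  fixes rate :: real and N :: "real \<Rightarrow> 'a \<Rightarrow> nat"
  assumes rate_pos: "0 < rate"
    and random_variable_N: "\<And>t. 0 \<le> t \<Longrightarrow> random_variable (count_space UNIV) (N t)"
    and N_0: "\<And>\<omega>. \<omega> \<in> space M \<Longrightarrow> N 0 \<omega> = 0"
    and N_mono: "\<And>\<omega> s t. \<omega> \<in> space M \<Longrightarrow> 0 \<le> s \<Longrightarrow> s \<le> t \<Longrightarrow> N s \<omega> \<le> N t \<omega>"
    and N_right_continuous:
      "\<And>\<omega> t. \<omega> \<in> space M \<Longrightarrow> 0 \<le> t \<Longrightarrow> eventually (\<lambda>s. N s \<omega> = N t \<omega>) (at_right t)"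
    and independent_increments:
      "\<And>(\<tau> :: nat \<Rightarrow> real) n. 0 \<le> \<tau> 0 \<Longrightarrow> (\<And>i. i < n \<Longrightarrow> \<tau> i < \<tau> (Suc i)) \<Longrightarrow>
         indep_vars (\<lambda>_. count_space UNIV) (\<lambda>i \<omega>. N (\<tau> (Suc i)) \<omega> - N (\<tau> i) \<omega>) {..<n}"
    and poisson_increments:
      "\<And>s t. 0 \<le> s \<Longrightarrow> s < t \<Longrightarrow>
         distr M (count_space UNIV) (\<lambda>\<omega>. N t \<omega> - N s \<omega>) = measure_pmf (poisson_pmf (rate * (t - s)))"

text \<open>
  The time \<open>S\<^sub>k\<close> of the \<open>k\<close>-th event of a counting path \<open>n\<close>, with \<open>S\<^sub>0 = 0\<close>. It is meaningful only
  if the path reaches \<open>k\<close>; below it is used up to time \<open>t\<close> only for \<open>k \<le> n t\<close>.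
\<close>
definition event_time :: "(real \<Rightarrow> nat) \<Rightarrow> nat \<Rightarrow> real" where
  "event_time n k = Inf {s. 0 \<le> s \<and> k \<le> n s}"

lemma event_time_0: "event_time n 0 = 0"
proof -
  have "{s :: real. 0 \<le> s \<and> 0 \<le> n s} = {0..}" by auto
  then show ?thesis by (simp add: event_time_def)
qed

text \<open>
  The hyperbolic distances are the nonnegative numbers with the prescribed hyperbolic cosines,
  hence values of \<^const>\<open>arcosh\<close>; the lemmas below record that these cosines are at least 1.
\<close>
definition particle_distance :: "real \<Rightarrow> (real \<Rightarrow> nat) \<Rightarrow> real \<Rightarrow> nat \<Rightarrow> real" where
  "particle_distance c n t k =
     arcosh (cosh (c * (t - event_time n k)) *
       (\<Prod>j=1..k. cosh (c * (event_time n j - event_time n (j - 1)))))"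

definition center_of_mass_distance :: "real \<Rightarrow> (real \<Rightarrow> nat) \<Rightarrow> real \<Rightarrow> real" where
  "center_of_mass_distance c n t =
     arcosh ((\<Sum>k<n t. 1 / 2 ^ (k + 1) * cosh (particle_distance c n t k)) +
       1 / 2 ^ n t * cosh (particle_distance c n t (n t)))"

lemma particle_distance:
  shows "0 \<le> particle_distance c n t k"
    and "cosh (particle_distance c n t k) = cosh (c * (t - event_time n k)) *
       (\<Prod>j=1..k. cosh (c * (event_time n j - event_time n (j - 1))))"
proof -
  have "1 \<le> (\<Prod>j=1..k. cosh (c * (event_time n j - event_time n (j - 1))))"
    by (intro prod_ge_1) (simp add: cosh_real_ge_1)
  then have "1 * 1 \<le> cosh (c * (t - event_time n k)) *
       (\<Prod>j=1..k. cosh (c * (event_time n j - event_time n (j - 1))))"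
    by (intro mult_mono) (simp_all add: cosh_real_ge_1)
  then show "0 \<le> particle_distance c n t k"
    and "cosh (particle_distance c n t k) = cosh (c * (t - event_time n k)) *
       (\<Prod>j=1..k. cosh (c * (event_time n j - event_time n (j - 1))))"
    unfolding particle_distance_def by simp_all
qed

lemma center_of_mass_distance:
  shows "0 \<le> center_of_mass_distance c n t"
    and "cosh (center_of_mass_distance c n t) =
       (\<Sum>k<n t. 1 / 2 ^ (k + 1) * cosh (particle_distance c n t k)) +
       1 / 2 ^ n t * cosh (particle_distance c n t (n t))"
proof -
  have "(\<Sum>k<m. 1 / 2 ^ (k + 1)) + 1 / 2 ^ m = (1 :: real)" for m
    by (induction m) (simp_all add: field_simps)
  then have "1 = (\<Sum>k<n t. 1 / 2 ^ (k + 1) * 1) + 1 / 2 ^ n t * (1 :: real)"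
    by simp
  also have "\<dots> \<le> (\<Sum>k<n t. 1 / 2 ^ (k + 1) * cosh (particle_distance c n t k)) +
       1 / 2 ^ n t * cosh (particle_distance c n t (n t))"
    by (intro add_mono sum_mono mult_left_mono) (simp_all add: cosh_real_ge_1)
  finally show "0 \<le> center_of_mass_distance c n t"
    and "cosh (center_of_mass_distance c n t) =
       (\<Sum>k<n t. 1 / 2 ^ (k + 1) * cosh (particle_distance c n t k)) +
       1 / 2 ^ n t * cosh (particle_distance c n t (n t))"
    unfolding center_of_mass_distance_def by simp_all
qed

end

theory Submission
  imports Defs
begin

text \<open>
  Let \<open>y\<close> be the mass-weighted hyperbolic cosine of the distance of the moving particle, \<open>z\<close> the same
  quantity with the last factor \<open>cosh (c (t - S\<^sub>N))\<close> replaced by \<open>sinh (c (t - S\<^sub>N))\<close>, and let \<open>x\<close> and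
  \<open>w\<close> be the corresponding sums over all particles, so that \<open>x = cosh \<eta>\<^sub>c\<^sub>m\<close>. Between events \<open>x' = c w\<close>,
  \<open>w' = c x\<close>, \<open>y' = c z\<close>, \<open>z' = c y\<close>, and at an event \<open>x\<close> stays, \<open>w\<close> loses \<open>z / 2\<close>, \<open>y\<close> is halved and
  \<open>z\<close> becomes 0. Hence the means solve the linear system \<open>x' = c w\<close>, \<open>w' = c x - \<lambda> z / 2\<close>,
  \<open>y' = c z - \<lambda> y / 2\<close>, \<open>z' = c y - \<lambda> z\<close>.

  To justify this without the joint law of the event times, divide \<open>[0, t]\<close> into \<open>m\<close> cells and delay
  every event to the right end of its cell. The delayed state is a product of random matrices that
  depend on the independent increments of the process, so its mean obeys an explicit recursion,
  which is a consistent and stable one-step scheme for the system. The delayed \<open>x\<close> is at most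
  \<open>exp (c t)\<close> and converges pathwise to \<open>cosh \<eta>\<^sub>c\<^sub>m\<close>, so dominated convergence applies.
\<close>

subsection \<open>Convergence of the one-step scheme\<close>

lemma continuous_on_Icc_abs_bound:
  fixes f :: "real \<Rightarrow> real"
  assumes "continuous_on {a..b} f"
  obtains B where "\<And>s. a \<le> s \<Longrightarrow> s \<le> b \<Longrightarrow> \<bar>f s\<bar> \<le> B"
proof -
  have "bounded (f ` {a..b})"
    using assms by (intro compact_imp_bounded compact_continuous_image) auto
  then obtain B where "\<forall>x\<in>{a..b}. \<bar>f x\<bar> \<le> B"
    by (auto simp: bounded_iff)
  then show ?thesis
    by (intro that[of B]) auto
qed

text \<open>The mean value theorem applied twice, with a bound of \<open>f''\<close> on
  \<open>[0, t]\<close> as constant. Over a principal filter, \<open>O\<close> means one constant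
  for all points of the set, so the estimate is uniform in \<open>s\<close> and \<open>h\<close>,
  not asymptotic.\<close>

lemma taylor_remainder_bound:
  fixes f f' f'' :: "real \<Rightarrow> real"
  assumes f: "\<And>s. (f has_real_derivative f' s) (at s)"
    and f': "\<And>s. (f' has_real_derivative f'' s) (at s)"
    and cont: "continuous_on {0..t} f''"
  shows "(\<lambda>(s, h). f (s + h) - f s - h * f' s) \<in>
    O[principal {(s, h). 0 \<le> s \<and> 0 \<le> h \<and> s + h \<le> t}](\<lambda>(s, h). h\<^sup>2)"
proof -
  obtain B where B: "\<And>s. 0 \<le> s \<Longrightarrow> s \<le> t \<Longrightarrow> \<bar>f'' s\<bar> \<le> B"
    using continuous_on_Icc_abs_bound[OF cont] by auto
  have "\<bar>f (s + h) - f s - h * f' s\<bar> \<le> B * h\<^sup>2" if sh: "0 \<le> s" "0 \<le> h" "s + h \<le> t" for s h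
  proof (cases "h = 0")
    case False
    then have h: "0 < h" using sh by simp
    obtain u where u: "s < u" "u < s + h" "f (s + h) - f s = h * f' u"
      using MVT2[of s "s + h" f f'] f h by auto
    obtain v where v: "s < v" "v < u" "f' u - f' s = (u - s) * f'' v"
      using MVT2[of s u f' f''] f' u by auto
    have "f (s + h) - f s - h * f' s = h * ((u - s) * f'' v)"
      unfolding v(3)[symmetric] using u(3) by (simp add: algebra_simps)
    also have "\<bar>\<dots>\<bar> = (h * (u - s)) * \<bar>f'' v\<bar>"
      using u h by (simp add: abs_mult)
    also have "\<dots> \<le> (h * h) * B"
      using u v h sh B[of v] by (intro mult_mono) auto
    finally show ?thesis by (simp add: power2_eq_square mult.commute)
  qed auto
  then show ?thesis
    by (intro bigoI[where c = B]) (auto simp: eventually_principal)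
qed

text \<open>First-order expansions multiply, because each leftover term contains a second-order
  factor. Boundedness of \<open>h\<close> is a separate assumption since the filter need not force
  \<open>h\<close> to 0.\<close>

lemma has_poly1_remainder_mult:
  fixes p q :: "'a \<Rightarrow> real" and F :: "'a filter"
  assumes p: "(\<lambda>x. p x - (a + b * h x)) \<in> O[F](\<lambda>x. (h x)\<^sup>2)"
    and q: "(\<lambda>x. q x - (a' + b' * h x)) \<in> O[F](\<lambda>x. (h x)\<^sup>2)"
    and h: "h \<in> O[F](\<lambda>_. 1)"
  shows "(\<lambda>x. p x * q x - (a * a' + (a * b' + a' * b) * h x)) \<in> O[F](\<lambda>x. (h x)\<^sup>2)"
proof -
  have lin: "(\<lambda>x. \<alpha> + \<beta> * h x) \<in> O[F](\<lambda>_. 1)" for \<alpha> \<beta>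
    using h by (intro sum_in_bigo) auto
  have h2: "(\<lambda>x. (h x)\<^sup>2) \<in> O[F](\<lambda>_. 1)"
    using landau_o.big.mult[OF h h] by (simp add: power2_eq_square)
  have q1: "q \<in> O[F](\<lambda>_. 1)"
    using sum_in_bigo(1)[OF landau_o.big.trans[OF q h2] lin[of a' b']] by simp
  have "(\<lambda>x. p x * q x - (a * a' + (a * b' + a' * b) * h x)) =
      (\<lambda>x. (p x - (a + b * h x)) * q x + (a + b * h x) * (q x - (a' + b' * h x)) + b * b' * (h x)\<^sup>2)"
    by (auto simp: algebra_simps power2_eq_square)
  also have "\<dots> \<in> O[F](\<lambda>x. (h x)\<^sup>2)"
    using landau_o.big.mult[OF p q1] landau_o.big.mult[OF lin[of a b] q]
    by (intro sum_in_bigo) (auto)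
  finally show ?thesis .
qed

text \<open>Stability of the flow in the maximum norm: both coefficients are nonnegative and add up
  to \<open>exp (c * h)\<close>.\<close>

lemma abs_flow_le:
  fixes c h a b E :: real
  assumes "0 \<le> c" "0 \<le> h" "\<bar>a\<bar> \<le> E" "\<bar>b\<bar> \<le> E"
  shows "\<bar>cosh (c * h) * a + sinh (c * h) * b\<bar> \<le> exp (c * h) * E"
proof -
  have "\<bar>cosh (c * h) * a + sinh (c * h) * b\<bar> \<le> cosh (c * h) * \<bar>a\<bar> + sinh (c * h) * \<bar>b\<bar>"
    using assms by (intro order.trans[OF abs_triangle_ineq]) (simp add: abs_mult)
  also have "\<dots> \<le> cosh (c * h) * E + sinh (c * h) * E"
    using assms by (intro add_mono mult_left_mono) auto
  also have "\<dots> = exp (c * h) * E"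
    by (simp add: cosh_plus_sinh[symmetric] algebra_simps)
  finally show ?thesis .
qed

text \<open>Consistency of the scheme. By the differential equations the first-order terms of the
  solution and of the one-step map agree, so each defect consists of a Taylor remainder and
  second-order coefficient errors times bounded functions.\<close>

lemma splitting_scheme_local_error:
  fixes x w y z :: "real \<Rightarrow> real" and c l t :: real
  assumes x: "\<And>s. (x has_real_derivative c * w s) (at s)"
    and w: "\<And>s. (w has_real_derivative c * x s - l / 2 * z s) (at s)"
    and y: "\<And>s. (y has_real_derivative c * z s - l / 2 * y s) (at s)"
    and z: "\<And>s. (z has_real_derivative c * y s - l * z s) (at s)"
  defines "dx \<equiv> \<lambda>s h. x (s + h) - (cosh (c * h) * x s + sinh (c * h) * w s)"
    and "dw \<equiv> \<lambda>s h. w (s + h) - (cosh (c * h) * w s + sinh (c * h) * x s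
        - (1 - exp (- (l * h))) / 2 * (cosh (c * h) * z s + sinh (c * h) * y s))"
    and "dy \<equiv> \<lambda>s h. y (s + h) - exp (- (l * h / 2)) * (cosh (c * h) * y s + sinh (c * h) * z s)"
    and "dz \<equiv> \<lambda>s h. z (s + h) - exp (- (l * h)) * (cosh (c * h) * z s + sinh (c * h) * y s)"
  obtains K where "0 < K" and "\<And>s h. 0 \<le> s \<Longrightarrow> 0 \<le> h \<Longrightarrow> s + h \<le> t \<Longrightarrow>
      \<bar>dx s h\<bar> + \<bar>dw s h\<bar> + \<bar>dy s h\<bar> + \<bar>dz s h\<bar> \<le> K * h\<^sup>2"
proof -
  define D where "D = {(s, h). (0::real) \<le> s \<and> (0::real) \<le> h \<and> s + h \<le> t}"
  let ?F = "principal D"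
  have bdd: "(\<lambda>(s, h). f s) \<in> O[?F](\<lambda>_. 1)" if "continuous_on {0..t} f" for f :: "real \<Rightarrow> real"
  proof -
    obtain B where "\<And>s. 0 \<le> s \<Longrightarrow> s \<le> t \<Longrightarrow> \<bar>f s\<bar> \<le> B"
      using continuous_on_Icc_abs_bound[OF \<open>continuous_on {0..t} f\<close>] by auto
    then show ?thesis
      by (intro bigoI[where c = B]) (auto simp: eventually_principal D_def)
  qed
  have hbdd: "(\<lambda>(s, h). h) \<in> O[?F](\<lambda>_. 1)"
    by (intro bigoI[where c = t]) (auto simp: eventually_principal D_def)
  have cont: "continuous_on A x" "continuous_on A w" "continuous_on A y" "continuous_on A z" for A
    using x w y z by (auto intro!: continuous_at_imp_continuous_on DERIV_isCont)
  note bd = cont[THEN bdd]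
  have tay: "(\<lambda>(s, h). x (s + h) - x s - h * (c * w s)) \<in> O[?F](\<lambda>(s, h). h\<^sup>2)"
    "(\<lambda>(s, h). w (s + h) - w s - h * (c * x s - l / 2 * z s)) \<in> O[?F](\<lambda>(s, h). h\<^sup>2)"
    "(\<lambda>(s, h). y (s + h) - y s - h * (c * z s - l / 2 * y s)) \<in> O[?F](\<lambda>(s, h). h\<^sup>2)"
    "(\<lambda>(s, h). z (s + h) - z s - h * (c * y s - l * z s)) \<in> O[?F](\<lambda>(s, h). h\<^sup>2)"
    unfolding D_def
    by (rule taylor_remainder_bound,
        rule x w y z, (rule derivative_eq_intros x w y z refl)+,
        (intro continuous_intros cont))+
  \<comment> \<open>A step coefficient depends on \<open>h\<close> only, so the Taylor estimate is
    used at base point 0; the pair \<open>(0, h)\<close> lies in \<open>D\<close> whenever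
    \<open>(s, h)\<close> does.\<close>
  have coeff: "(\<lambda>(s, h). p h - (a + b * h)) \<in> O[?F](\<lambda>(s, h). h\<^sup>2)"
    if p: "\<And>s. (p has_real_derivative p' s) (at s)" "\<And>s. (p' has_real_derivative p'' s) (at s)"
      "continuous_on {0..t} p''" and "p 0 = a" "p' 0 = b" for p p' p'' :: "real \<Rightarrow> real" and a b
  proof -
    obtain K where K: "\<forall>(s, h)\<in>D. \<bar>p (s + h) - p s - h * p' s\<bar> \<le> K * h\<^sup>2"
      using taylor_remainder_bound[OF p] unfolding bigo_def D_def
      by (auto simp: eventually_principal)
    have "\<bar>p h - (a + b * h)\<bar> \<le> K * h\<^sup>2" if "(s, h) \<in> D" for s h
      using bspec[OF K, of "(0, h)"] that \<open>p 0 = a\<close> \<open>p' 0 = b\<close> by (auto simp: D_def algebra_simps)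
    then show ?thesis
      by (intro bigoI[where c = K]) (auto simp: eventually_principal)
  qed
  have C: "(\<lambda>(s, h). cosh (c * h) - (1 + 0 * h)) \<in> O[?F](\<lambda>(s, h). h\<^sup>2)"
    by (rule coeff[of "\<lambda>h. cosh (c * h)" "\<lambda>h. c * sinh (c * h)" "\<lambda>h. c * (c * cosh (c * h))"])
      (auto intro!: derivative_eq_intros continuous_intros)
  have S: "(\<lambda>(s, h). sinh (c * h) - (0 + c * h)) \<in> O[?F](\<lambda>(s, h). h\<^sup>2)"
    by (rule coeff[of "\<lambda>h. sinh (c * h)" "\<lambda>h. c * cosh (c * h)" "\<lambda>h. c * (c * sinh (c * h))"])
      (auto intro!: derivative_eq_intros continuous_intros)
  have e: "(\<lambda>(s, h). exp (- (l * h)) - (1 + (- l) * h)) \<in> O[?F](\<lambda>(s, h). h\<^sup>2)" for l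
    by (rule coeff[of "\<lambda>h. exp (- (l * h))" "\<lambda>h. - l * exp (- (l * h))" "\<lambda>h. l * l * exp (- (l * h))"])
      (auto intro!: derivative_eq_intros continuous_intros)
  have u: "(\<lambda>(s, h). (1 - exp (- (l * h))) / 2 - (0 + l / 2 * h)) \<in> O[?F](\<lambda>(s, h). h\<^sup>2)"
    by (rule coeff[of "\<lambda>h. (1 - exp (- (l * h))) / 2" "\<lambda>h. l * exp (- (l * h)) / 2" "\<lambda>h. - l * l * exp (- (l * h)) / 2"])
      (auto intro!: derivative_eq_intros continuous_intros)
  have e2: "(\<lambda>(s, h). exp (- (l * h / 2)) - (1 + (- (l / 2)) * h)) \<in> O[?F](\<lambda>(s, h). h\<^sup>2)"
    using e[of "l / 2"] by simp
  note [simp] = case_prod_unfold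
  note mult = has_poly1_remainder_mult[where h = snd and F = ?F, OF _ _ hbdd[simplified]]
  note eq' = e2[simplified] and ep' = e[of l, simplified]
  have eqC: "(\<lambda>(s, h). exp (- (l * h / 2)) * cosh (c * h) - (1 + - (l / 2) * h)) \<in> O[?F](\<lambda>(s, h). h\<^sup>2)"
    using mult[of "\<lambda>p. exp (- (l * snd p / 2))" 1 "- (l / 2)" "\<lambda>p. cosh (c * snd p)" 1 0] C eq' by simp
  have eqS: "(\<lambda>(s, h). exp (- (l * h / 2)) * sinh (c * h) - (0 + c * h)) \<in> O[?F](\<lambda>(s, h). h\<^sup>2)"
    using mult[of "\<lambda>p. exp (- (l * snd p / 2))" 1 "- (l / 2)" "\<lambda>p. sinh (c * snd p)" 0 c] S eq' by simp
  have epC: "(\<lambda>(s, h). exp (- (l * h)) * cosh (c * h) - (1 + - l * h)) \<in> O[?F](\<lambda>(s, h). h\<^sup>2)"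
    using mult[of "\<lambda>p. exp (- (l * snd p))" 1 "- l" "\<lambda>p. cosh (c * snd p)" 1 0] C ep' by simp
  have epS: "(\<lambda>(s, h). exp (- (l * h)) * sinh (c * h) - (0 + c * h)) \<in> O[?F](\<lambda>(s, h). h\<^sup>2)"
    using mult[of "\<lambda>p. exp (- (l * snd p))" 1 "- l" "\<lambda>p. sinh (c * snd p)" 0 c] S ep' by simp
  have uC: "(\<lambda>(s, h). (1 - exp (- (l * h))) / 2 * cosh (c * h) - (0 + l / 2 * h)) \<in> O[?F](\<lambda>(s, h). h\<^sup>2)"
    using mult[of "\<lambda>p. (1 - exp (- (l * snd p))) / 2" 0 "l / 2" "\<lambda>p. cosh (c * snd p)" 1 0] C u by simp
  have uS: "(\<lambda>(s, h). (1 - exp (- (l * h))) / 2 * sinh (c * h) - (0 + 0 * h)) \<in> O[?F](\<lambda>(s, h). h\<^sup>2)"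
    using mult[of "\<lambda>p. (1 - exp (- (l * snd p))) / 2" 0 "l / 2" "\<lambda>p. sinh (c * snd p)" 0 c] S u by simp
  have prod_bigo: "(\<lambda>(s, h). p s h * v s) \<in> O[?F](\<lambda>(s, h). h\<^sup>2)"
    if "(\<lambda>(s, h). p s h) \<in> O[?F](\<lambda>(s, h). h\<^sup>2)" "(\<lambda>(s, h). v s) \<in> O[?F](\<lambda>_. 1)" for p v
    using landau_o.big.mult[OF that] by simp
  have "(\<lambda>(s, h). dx s h) = (\<lambda>(s, h). (x (s + h) - x s - h * (c * w s))
      - (cosh (c * h) - (1 + 0 * h)) * x s - (sinh (c * h) - (0 + c * h)) * w s)"
    by (auto simp: dx_def algebra_simps)
  also have "\<dots> \<in> O[?F](\<lambda>(s, h). h\<^sup>2)"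
    using sum_in_bigo(2)[OF sum_in_bigo(2)[OF tay(1) prod_bigo[OF C bd(1)]] prod_bigo[OF S bd(2)]]
    unfolding case_prod_unfold .
  finally have dx: "(\<lambda>(s, h). dx s h) \<in> O[?F](\<lambda>(s, h). h\<^sup>2)" .
  have "(\<lambda>(s, h). dw s h) = (\<lambda>(s, h). (w (s + h) - w s - h * (c * x s - l / 2 * z s))
      - (cosh (c * h) - (1 + 0 * h)) * w s - (sinh (c * h) - (0 + c * h)) * x s
      + ((1 - exp (- (l * h))) / 2 * cosh (c * h) - (0 + l / 2 * h)) * z s
      + ((1 - exp (- (l * h))) / 2 * sinh (c * h) - (0 + 0 * h)) * y s)"
    by (auto simp: dw_def algebra_simps)
  also have "\<dots> \<in> O[?F](\<lambda>(s, h). h\<^sup>2)"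
    using sum_in_bigo(1)[OF sum_in_bigo(1)[OF sum_in_bigo(2)[OF sum_in_bigo(2)[OF tay(2)
      prod_bigo[OF C bd(2)]] prod_bigo[OF S bd(1)]] prod_bigo[OF uC bd(4)]] prod_bigo[OF uS bd(3)]]
    unfolding case_prod_unfold .
  finally have dw: "(\<lambda>(s, h). dw s h) \<in> O[?F](\<lambda>(s, h). h\<^sup>2)" .
  have "(\<lambda>(s, h). dy s h) = (\<lambda>(s, h). (y (s + h) - y s - h * (c * z s - l / 2 * y s))
      - (exp (- (l * h / 2)) * cosh (c * h) - (1 + - (l / 2) * h)) * y s
      - (exp (- (l * h / 2)) * sinh (c * h) - (0 + c * h)) * z s)"
    by (auto simp: dy_def algebra_simps)
  also have "\<dots> \<in> O[?F](\<lambda>(s, h). h\<^sup>2)"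
    using sum_in_bigo(2)[OF sum_in_bigo(2)[OF tay(3) prod_bigo[OF eqC bd(3)]] prod_bigo[OF eqS bd(4)]]
    unfolding case_prod_unfold .
  finally have dy: "(\<lambda>(s, h). dy s h) \<in> O[?F](\<lambda>(s, h). h\<^sup>2)" .
  have "(\<lambda>(s, h). dz s h) = (\<lambda>(s, h). (z (s + h) - z s - h * (c * y s - l * z s))
      - (exp (- (l * h)) * cosh (c * h) - (1 + - l * h)) * z s
      - (exp (- (l * h)) * sinh (c * h) - (0 + c * h)) * y s)"
    by (auto simp: dz_def algebra_simps)
  also have "\<dots> \<in> O[?F](\<lambda>(s, h). h\<^sup>2)"
    using sum_in_bigo(2)[OF sum_in_bigo(2)[OF tay(4) prod_bigo[OF epC bd(4)]] prod_bigo[OF epS bd(3)]]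
    unfolding case_prod_unfold .
  finally have dz: "(\<lambda>(s, h). dz s h) \<in> O[?F](\<lambda>(s, h). h\<^sup>2)" .
  have "(\<lambda>(s, h). \<bar>dx s h\<bar> + \<bar>dw s h\<bar> + \<bar>dy s h\<bar> + \<bar>dz s h\<bar>) \<in> O[?F](\<lambda>(s, h). h\<^sup>2)"
    using dx dw dy dz unfolding case_prod_unfold
    by (intro sum_in_bigo) (simp_all add: landau_o.big.abs_in_iff)
  then obtain K where "0 < K" and
    K: "\<forall>p\<in>D. \<bar>dx (fst p) (snd p)\<bar> + \<bar>dw (fst p) (snd p)\<bar> + \<bar>dy (fst p) (snd p)\<bar>
      + \<bar>dz (fst p) (snd p)\<bar> \<le> K * (snd p)\<^sup>2"
    by (rule landau_o.bigE) (auto simp: eventually_principal)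
  show ?thesis
    by (rule that[OF \<open>0 < K\<close>]) (use K in \<open>auto simp: D_def\<close>)
qed

text \<open>
  The one-step map with \<open>h\<close> the mesh size is the exact flow over a cell followed by the averaged jump.
\<close>
lemma splitting_scheme_tendsto:
  fixes x w y z :: "real \<Rightarrow> real" and X W Y Z :: "nat \<Rightarrow> nat \<Rightarrow> real" and c l t :: real
  assumes c: "0 \<le> c" and l: "0 \<le> l" and t: "0 < t"
    and x: "\<And>s. (x has_real_derivative c * w s) (at s)"
    and w: "\<And>s. (w has_real_derivative c * x s - l / 2 * z s) (at s)"
    and y: "\<And>s. (y has_real_derivative c * z s - l / 2 * y s) (at s)"
    and z: "\<And>s. (z has_real_derivative c * y s - l * z s) (at s)"
    and init: "\<And>m. X m 0 = x 0" "\<And>m. W m 0 = w 0" "\<And>m. Y m 0 = y 0" "\<And>m. Z m 0 = z 0"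
    and stepX: "\<And>m i. 0 < m \<Longrightarrow> X m (Suc i) = cosh (c * (t / m)) * X m i + sinh (c * (t / m)) * W m i"
    and stepW: "\<And>m i. 0 < m \<Longrightarrow> W m (Suc i) = cosh (c * (t / m)) * W m i + sinh (c * (t / m)) * X m i
        - (1 - exp (- (l * (t / m)))) / 2 * (cosh (c * (t / m)) * Z m i + sinh (c * (t / m)) * Y m i)"
    and stepY: "\<And>m i. 0 < m \<Longrightarrow> Y m (Suc i) = exp (- (l * (t / m) / 2)) *
        (cosh (c * (t / m)) * Y m i + sinh (c * (t / m)) * Z m i)"
    and stepZ: "\<And>m i. 0 < m \<Longrightarrow> Z m (Suc i) = exp (- (l * (t / m))) *
        (cosh (c * (t / m)) * Z m i + sinh (c * (t / m)) * Y m i)"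
  shows "(\<lambda>m. X m m) \<longlonglongrightarrow> x t"
proof -
  define dx where "dx = (\<lambda>s h. x (s + h) - (cosh (c * h) * x s + sinh (c * h) * w s))"
  define dw where "dw = (\<lambda>s h. w (s + h) - (cosh (c * h) * w s + sinh (c * h) * x s
        - (1 - exp (- (l * h))) / 2 * (cosh (c * h) * z s + sinh (c * h) * y s)))"
  define dy where "dy = (\<lambda>s h. y (s + h) - exp (- (l * h / 2)) * (cosh (c * h) * y s + sinh (c * h) * z s))"
  define dz where "dz = (\<lambda>s h. z (s + h) - exp (- (l * h)) * (cosh (c * h) * z s + sinh (c * h) * y s))"
  obtain K where "0 < K" and K: "\<And>s h. 0 \<le> s \<Longrightarrow> 0 \<le> h \<Longrightarrow> s + h \<le> t \<Longrightarrow>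
      \<bar>dx s h\<bar> + \<bar>dw s h\<bar> + \<bar>dy s h\<bar> + \<bar>dz s h\<bar> \<le> K * h\<^sup>2"
    using splitting_scheme_local_error[OF x w y z, of t] unfolding dx_def dw_def dy_def dz_def
    by metis
  \<comment> \<open>Growth rate of errors in the maximum norm: \<open>c\<close> comes from the flow,
    \<open>l / 2\<close> from the jump term in \<open>W\<close>.\<close>
  define L where "L = c + l / 2"
  \<comment> \<open>A discrete Gronwall estimate: \<open>i\<close> local errors accumulate, each
    amplified by at most \<open>exp (L * (i * (t / m)))\<close>.\<close>
  have err: "\<bar>X m i - x (i * (t / m))\<bar> \<le> E \<and> \<bar>W m i - w (i * (t / m))\<bar> \<le> E \<and>
      \<bar>Y m i - y (i * (t / m))\<bar> \<le> E \<and> \<bar>Z m i - z (i * (t / m))\<bar> \<le> E"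
    if "i \<le> m" "0 < m" and E: "E = i * (K * (t / m)\<^sup>2) * exp (L * (i * (t / m)))" for m i :: nat and E
    using that(1) E
  proof (induction i arbitrary: E)
    case (Suc i)
    define h where "h = t / m"
    define s where "s = i * h"
    define E' where "E' = i * (K * h\<^sup>2) * exp (L * (i * h))"
    have h: "0 \<le> h" using t that(2) by (simp add: h_def)
    have "s + h = (i + 1) * t / m" by (simp add: s_def h_def algebra_simps add_divide_distrib)
    also have "\<dots> \<le> t"
    proof -
      have "(i + 1) * t \<le> m * t" using Suc.prems(1) t by (intro mult_right_mono) auto
      then show ?thesis using that(2) by (simp add: field_simps)
    qed
    finally have "s + h \<le> t" .
    then have K: "\<bar>dx s h\<bar> + \<bar>dw s h\<bar> + \<bar>dy s h\<bar> + \<bar>dz s h\<bar> \<le> K * h\<^sup>2"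
      using K h by (simp add: s_def)
    have IH: "\<bar>X m i - x s\<bar> \<le> E'" "\<bar>W m i - w s\<bar> \<le> E'" "\<bar>Y m i - y s\<bar> \<le> E'" "\<bar>Z m i - z s\<bar> \<le> E'"
      using Suc.IH[of E'] Suc.prems by (auto simp: E'_def s_def h_def)
    have E': "0 \<le> E'" using IH(1) by simp
    note fl = abs_flow_le[OF c h]
    have Eb: "exp (L * h) * E' + K * h\<^sup>2 \<le> E"
    proof -
      have "exp (L * h) * E' + K * h\<^sup>2 * 1 \<le> exp (L * h) * E' + K * h\<^sup>2 * exp (L * (Suc i * h))"
        using h c l \<open>0 < K\<close> by (intro add_left_mono mult_left_mono) (auto simp: L_def)
      also have "\<dots> = E"
        by (simp add: E'_def Suc.prems h_def[symmetric] exp_add[symmetric] algebra_simps)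
      finally show ?thesis by simp
    qed
    have cL: "exp (c * h) \<le> exp (L * h)"
      using h l by (simp add: L_def algebra_simps)
    have le: "\<bar>a\<bar> \<le> E" if "a = b - d" "\<bar>b\<bar> \<le> exp (L * h) * E'" "\<bar>d\<bar> \<le> K * h\<^sup>2" for a b d
      using that Eb by linarith
    have fl': "\<bar>cosh (c * h) * a + sinh (c * h) * b\<bar> \<le> exp (L * h) * E'"
      if "\<bar>a\<bar> \<le> E'" "\<bar>b\<bar> \<le> E'" for a b
      using fl[OF that] mult_right_mono[OF cL E'] by linarith
    have fl'': "\<bar>exp (- r) * (cosh (c * h) * a + sinh (c * h) * b)\<bar> \<le> exp (L * h) * E'"
      if "\<bar>a\<bar> \<le> E'" "\<bar>b\<bar> \<le> E'" "0 \<le> r" for a b r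
    proof -
      have "exp (- r) * \<bar>cosh (c * h) * a + sinh (c * h) * b\<bar> \<le> 1 * (exp (L * h) * E')"
        using that by (intro mult_mono fl') auto
      then show ?thesis by (simp add: abs_mult)
    qed
    let ?u = "(1 - exp (- (l * h))) / 2"
    \<comment> \<open>Only the \<open>W\<close> step can amplify errors beyond the flow, by the
      factor \<open>1 + ?u\<close>; the factors in the \<open>Y\<close> and \<open>Z\<close> steps
      are at most 1.\<close>
    have u: "0 \<le> ?u" "1 + ?u \<le> exp (l / 2 * h)"
    proof -
      show "0 \<le> ?u" using l h by simp
      have "1 - exp (- (l * h)) \<le> l * h" using exp_ge_add_one_self[of "- (l * h)"] by simp
      then have "1 + ?u \<le> 1 + l / 2 * h" by simp
      also have "\<dots> \<le> exp (l / 2 * h)" by (rule exp_ge_add_one_self)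
      finally show "1 + ?u \<le> exp (l / 2 * h)" .
    qed
    have W: "\<bar>(cosh (c * h) * (W m i - w s) + sinh (c * h) * (X m i - x s))
      - ?u * (cosh (c * h) * (Z m i - z s) + sinh (c * h) * (Y m i - y s))\<bar> \<le> exp (L * h) * E'"
      (is "\<bar>?a - ?u * ?b\<bar> \<le> _")
    proof -
      have "\<bar>?a - ?u * ?b\<bar> \<le> \<bar>?a\<bar> + ?u * \<bar>?b\<bar>"
        using u(1) by (metis abs_mult abs_of_nonneg abs_triangle_ineq4)
      also have "\<dots> \<le> exp (c * h) * E' + ?u * (exp (c * h) * E')"
        using u(1) IH by (intro add_mono mult_left_mono fl) auto
      also have "\<dots> = (1 + ?u) * (exp (c * h) * E')" by (simp add: algebra_simps)
      also have "\<dots> \<le> exp (l / 2 * h) * (exp (c * h) * E')"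
        using u E' by (intro mult_right_mono) auto
      also have "\<dots> = exp (L * h) * E'" by (simp add: L_def exp_add algebra_simps)
      finally show ?thesis .
    qed
    have sh: "Suc i * (t / m) = s + h" by (simp add: s_def h_def algebra_simps add_divide_distrib)
    note steps = stepX[OF that(2), folded h_def] stepW[OF that(2), folded h_def]
      stepY[OF that(2), folded h_def] stepZ[OF that(2), folded h_def]
    have d: "\<bar>dx s h\<bar> \<le> K * h\<^sup>2" "\<bar>dw s h\<bar> \<le> K * h\<^sup>2" "\<bar>dy s h\<bar> \<le> K * h\<^sup>2" "\<bar>dz s h\<bar> \<le> K * h\<^sup>2"
      using K by linarith+
    have eX: "X m (Suc i) - x (s + h) =
        (cosh (c * h) * (X m i - x s) + sinh (c * h) * (W m i - w s)) - dx s h"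
      by (simp add: dx_def steps algebra_simps)
    have eW: "W m (Suc i) - w (s + h) =
        (cosh (c * h) * (W m i - w s) + sinh (c * h) * (X m i - x s))
          - ?u * (cosh (c * h) * (Z m i - z s) + sinh (c * h) * (Y m i - y s)) - dw s h"
      unfolding dw_def steps by algebra
    have eY: "Y m (Suc i) - y (s + h) =
        exp (- (l * h / 2)) * (cosh (c * h) * (Y m i - y s) + sinh (c * h) * (Z m i - z s)) - dy s h"
      unfolding dy_def steps by algebra
    have eZ: "Z m (Suc i) - z (s + h) =
        exp (- (l * h)) * (cosh (c * h) * (Z m i - z s) + sinh (c * h) * (Y m i - y s)) - dz s h"
      unfolding dz_def steps by algebra
    show ?case unfolding sh
      using le[OF eX fl'[OF IH(1,2)] d(1)] le[OF eW W d(2)]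
        le[OF eY fl''[OF IH(3,4)] d(3)] le[OF eZ fl''[OF IH(4,3)] d(4)] h l
      by simp
  qed (simp add: init)
  \<comment> \<open>At \<open>i = m\<close>, a total of \<open>m\<close> local errors of order
    \<open>(t / m)^2\<close> leaves order \<open>1 / m\<close>.\<close>
  have "\<bar>X m m - x t\<bar> \<le> K * t\<^sup>2 * exp (L * t) / m" if "0 < m" for m
    using err[OF order.refl that refl] that by (simp add: power2_eq_square)
  then have "eventually (\<lambda>m. norm (X m m - x t) \<le> K * t\<^sup>2 * exp (L * t) / m) sequentially"
    by (intro eventually_mono[OF eventually_gt_at_top[of 0]]) auto
  then have "(\<lambda>m. X m m - x t) \<longlonglongrightarrow> 0"
    by (rule Lim_null_comparison) (rule lim_const_over_n)
  then show ?thesis by (simp add: LIM_zero_iff)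
qed

subsection \<open>Solution of the mean system\<close>

text \<open>
  Writing the solution with \<open>(exp (p t) - 1) / p\<close>, continued by \<open>t\<close> at \<open>p = 0\<close>, covers the resonant case
  \<open>l = 3 c\<close>, where the eigenvalue \<open>rate_plus c l\<close> equals \<open>- c\<close>.
\<close>

definition growth :: "real \<Rightarrow> real \<Rightarrow> real" where
  "growth p t = (if p = 0 then t else (exp (p * t) - 1) / p)"

lemma growth_0_right [simp]: "growth p 0 = 0"
  by (simp add: growth_def)

lemma DERIV_growth [derivative_intros]: "(growth p has_real_derivative exp (p * t)) (at t)"
proof (cases "p = 0")
  case True
  then show ?thesis by (simp add: growth_def[abs_def])
next
  case False
  then show ?thesis
    unfolding growth_def[abs_def] by (auto intro!: derivative_eq_intros)
qed

text \<open>At \<open>p = 0\<close> the value \<open>t\<close> is the derivative of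
  \<open>exp (p * t)\<close> with respect to \<open>p\<close>, hence the limit of the difference
  quotient. This makes the resonant rate reachable as a limit.\<close>

lemma isCont_growth: "isCont (\<lambda>p. growth p t) q"
proof (cases "q = 0")
  case True
  have "(\<lambda>p. (exp (p * t) - 1) / p) \<midarrow>0\<rightarrow> t"
  proof -
    have "((\<lambda>p. exp (p * t)) has_real_derivative t) (at 0)"
      by (auto intro!: derivative_eq_intros)
    then show ?thesis by (simp add: DERIV_def)
  qed
  moreover have "eventually (\<lambda>p. (exp (p * t) - 1) / p = growth p t) (at 0)"
    by (auto simp: eventually_at_filter growth_def)
  ultimately have "(\<lambda>p. growth p t) \<midarrow>0\<rightarrow> t"
    by (rule Lim_transform_eventually)
  then show ?thesis using True by (simp add: isCont_def growth_def)
next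
  case False
  have "isCont (\<lambda>p. (exp (p * t) - 1) / p) q"
    using False by (auto intro!: continuous_intros)
  moreover have "eventually (\<lambda>p. (exp (p * t) - 1) / p = growth p t) (nhds q)"
    using t1_space_nhds[OF False] by eventually_elim (auto simp: growth_def)
  ultimately show ?thesis
    by (rule isCont_cong[THEN iffD1, rotated])
qed

text \<open>The eigenvalues of the system \<open>y' = c z - l y / 2\<close>, \<open>z' = c y - l z\<close>.\<close>

definition rate_plus :: "real \<Rightarrow> real \<Rightarrow> real" where
  "rate_plus c l = (sqrt (l\<^sup>2 + 16 * c\<^sup>2) - 3 * l) / 4"

definition rate_minus :: "real \<Rightarrow> real \<Rightarrow> real" where
  "rate_minus c l = (- sqrt (l\<^sup>2 + 16 * c\<^sup>2) - 3 * l) / 4"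

text \<open>The solution of the \<open>y\<close>, \<open>z\<close> system started at
  \<open>y = 1\<close>, \<open>z = 0\<close>; \<open>mean_y\<close> is read off from it as
  \<open>(z' + l z) / c\<close>.\<close>

definition mean_z :: "real \<Rightarrow> real \<Rightarrow> real \<Rightarrow> real" where
  "mean_z c l s = 2 * c / sqrt (l\<^sup>2 + 16 * c\<^sup>2) * (exp (rate_plus c l * s) - exp (rate_minus c l * s))"

definition mean_y :: "real \<Rightarrow> real \<Rightarrow> real \<Rightarrow> real" where
  "mean_y c l s = 2 / sqrt (l\<^sup>2 + 16 * c\<^sup>2) *
     ((rate_plus c l + l) * exp (rate_plus c l * s) - (rate_minus c l + l) * exp (rate_minus c l * s))"

text \<open>The antiderivative of \<open>exp (- (a * s)) * mean_z c l s\<close> that vanishes at 0;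
  \<open>growth\<close> covers the case of an eigenvalue equal to \<open>a\<close>.\<close>

definition damped_integral :: "real \<Rightarrow> real \<Rightarrow> real \<Rightarrow> real \<Rightarrow> real" where
  "damped_integral c l a s = 2 * c / sqrt (l\<^sup>2 + 16 * c\<^sup>2) *
     (growth (rate_plus c l - a) s - growth (rate_minus c l - a) s)"

text \<open>Variation of constants: \<open>x + w\<close> and \<open>x - w\<close> solve scalar
  equations with rates \<open>c\<close> and \<open>- c\<close> and forcing terms
  \<open>- l z / 2\<close> and \<open>l z / 2\<close>. Half their sum is \<open>mean_x\<close>, half
  their difference \<open>mean_w\<close>.\<close>

definition mean_x :: "real \<Rightarrow> real \<Rightarrow> real \<Rightarrow> real" where
  "mean_x c l s = cosh (c * s) - l / 4 *
     (exp (c * s) * damped_integral c l c s - exp (- (c * s)) * damped_integral c l (- c) s)"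

definition mean_w :: "real \<Rightarrow> real \<Rightarrow> real \<Rightarrow> real" where
  "mean_w c l s = sinh (c * s) - l / 4 *
     (exp (c * s) * damped_integral c l c s + exp (- (c * s)) * damped_integral c l (- c) s)"

lemma DERIV_damped_integral:
  "(damped_integral c l a has_real_derivative exp (- (a * s)) * mean_z c l s) (at s)"
proof -
  define k where "k = 2 * c / sqrt (l\<^sup>2 + 16 * c\<^sup>2)"
  have "exp ((r - a) * s) = exp (- (a * s)) * exp (r * s)" for r
    by (simp add: mult_exp_exp left_diff_distrib)
  then have "exp (- (a * s)) * mean_z c l s =
      k * (exp ((rate_plus c l - a) * s) - exp ((rate_minus c l - a) * s))"
    unfolding mean_z_def k_def[symmetric] by (simp add: right_diff_distrib)
  then show ?thesis
    unfolding damped_integral_def[abs_def] k_def[symmetric]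
    by (simp only:) (intro DERIV_cmult DERIV_diff DERIV_growth)
qed

lemma DERIV_mean_x: "(mean_x c l has_real_derivative c * mean_w c l s) (at s)"
  unfolding mean_x_def[abs_def] mean_w_def
  by (auto intro!: derivative_eq_intros DERIV_damped_integral simp: exp_minus field_simps)

lemma DERIV_mean_w: "(mean_w c l has_real_derivative c * mean_x c l s - l / 2 * mean_z c l s) (at s)"
  unfolding mean_w_def[abs_def] mean_x_def
  by (auto intro!: derivative_eq_intros DERIV_damped_integral simp: exp_minus field_simps)

context
  fixes c l :: real
  assumes c: "0 < c" and l: "0 < l"
begin

lemma discriminant_pos: "0 < sqrt (l\<^sup>2 + 16 * c\<^sup>2)"
  using c by (simp add: add_nonneg_pos)

lemma discriminant_square: "sqrt (l\<^sup>2 + 16 * c\<^sup>2) * sqrt (l\<^sup>2 + 16 * c\<^sup>2) = l\<^sup>2 + 16 * c\<^sup>2"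
  by simp

text \<open>The characteristic equation of the \<open>y\<close>, \<open>z\<close> system at its two
  roots.\<close>

lemma rate_identities:
  "(rate_plus c l + l) * (rate_plus c l + l / 2) = c\<^sup>2"
  "(rate_minus c l + l) * (rate_minus c l + l / 2) = c\<^sup>2"
  using discriminant_square by (simp_all add: rate_plus_def rate_minus_def field_simps power2_eq_square)

lemma DERIV_mean_z: "(mean_z c l has_real_derivative c * mean_y c l s - l * mean_z c l s) (at s)"
proof -
  define k where "k = 2 / sqrt (l\<^sup>2 + 16 * c\<^sup>2)"
  have "2 * c / sqrt (l\<^sup>2 + 16 * c\<^sup>2) = c * k" by (simp add: k_def)
  then show ?thesis
    unfolding mean_z_def[abs_def] mean_y_def k_def[symmetric]
    by (auto intro!: derivative_eq_intros simp: algebra_simps)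
qed

text \<open>The equation for \<open>z\<close> holds by the choice of \<open>mean_y\<close>; this one
  is where the characteristic equation enters, to rewrite \<open>(r + l) * r\<close>.\<close>

lemma DERIV_mean_y: "(mean_y c l has_real_derivative c * mean_z c l s - l / 2 * mean_y c l s) (at s)"
proof -
  have id: "(r + l) * r = c\<^sup>2 - l / 2 * (r + l)" if "(r + l) * (r + l / 2) = c\<^sup>2" for r
    using that by (simp add: algebra_simps)
  note ids = rate_identities[THEN id]
  define k where "k = 2 / sqrt (l\<^sup>2 + 16 * c\<^sup>2)"
  have ck: "2 * c / sqrt (l\<^sup>2 + 16 * c\<^sup>2) = c * k" by (simp add: k_def)
  have "(mean_y c l has_real_derivative k *
     (((rate_plus c l + l) * rate_plus c l) * exp (rate_plus c l * s)
      - ((rate_minus c l + l) * rate_minus c l) * exp (rate_minus c l * s))) (at s)"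
    unfolding mean_y_def[abs_def] k_def[symmetric]
    by (intro DERIV_cmult) (auto intro!: derivative_eq_intros simp: algebra_simps)
  also have "k * (((rate_plus c l + l) * rate_plus c l) * exp (rate_plus c l * s)
      - ((rate_minus c l + l) * rate_minus c l) * exp (rate_minus c l * s)) =
      c * mean_z c l s - l / 2 * mean_y c l s"
    unfolding ids mean_y_def mean_z_def k_def[symmetric] ck
    by algebra
  finally show ?thesis .
qed

lemma mean_init: "mean_x c l 0 = 1" "mean_w c l 0 = 0" "mean_y c l 0 = 1" "mean_z c l 0 = 0"
  using discriminant_pos
  by (simp_all add: mean_x_def mean_w_def mean_y_def mean_z_def damped_integral_def
      rate_plus_def rate_minus_def field_simps)

text \<open>Away from resonance every \<open>growth\<close> term is a genuine quotient, so the
  solution combines four exponentials, with rates \<open>p\<close>, \<open>q\<close>,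
  \<open>c\<close> and \<open>- c\<close>. Partial fractions identify the coefficients.\<close>

lemma mean_x_closed_form:
  assumes "l \<noteq> 3 * c"
  shows "mean_x c l t = 2 ^ 3 * c\<^sup>2 * exp (- (3 / 4) * l * t) / sqrt (l\<^sup>2 + 16 * c\<^sup>2) *
       (exp (- (t / 4) * sqrt (l\<^sup>2 + 16 * c\<^sup>2)) / (3 * sqrt (l\<^sup>2 + 16 * c\<^sup>2) + 5 * l)
        + exp (t / 4 * sqrt (l\<^sup>2 + 16 * c\<^sup>2)) / (3 * sqrt (l\<^sup>2 + 16 * c\<^sup>2) - 5 * l))
     + (l + 2 * c) / (2 * (l + 3 * c)) * exp (c * t)
     + (l - 2 * c) / (2 * (l - 3 * c)) * exp (- (c * t))"
proof -
  define R where "R = sqrt (l\<^sup>2 + 16 * c\<^sup>2)"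
  define p where "p = (R - 3 * l) / 4"
  define q where "q = (- R - 3 * l) / 4"
  have R: "0 < R" "R * R = l * l + 16 * c * c"
    using discriminant_pos discriminant_square by (simp_all add: R_def power2_eq_square)
  \<comment> \<open>All denominators below reduce to these four products, which need only the value
    of \<open>R * R\<close>.\<close>
  have prods: "(p - c) * (q - c) = l * (l + 3 * c) / 2" "(p + c) * (q + c) = l * (l - 3 * c) / 2"
    "(p - c) * (p + c) = - (l * (3 * R - 5 * l) / 8)" "(q - c) * (q + c) = l * (5 * l + 3 * R) / 8"
    using R(2) by (simp_all add: p_def q_def field_simps)
  \<comment> \<open>The factor \<open>3 * c - l\<close> shows that \<open>3 * R - 5 * l\<close>
    vanishes exactly at the excluded resonant rate.\<close>
  have "(3 * R + 5 * l) * (3 * R - 5 * l) = 16 * (3 * c - l) * (3 * c + l)"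
    using R(2) by (simp add: field_simps)
  then have nz: "3 * R - 5 * l \<noteq> 0" "3 * R + 5 * l \<noteq> 0" "l - 3 * c \<noteq> 0" "l + 3 * c \<noteq> 0" "5 * l - 3 * R \<noteq> 0" "5 * l + 3 * R \<noteq> 0"
    using assms c l R(1) by (auto simp: add_pos_pos)
  have nz': "p - c \<noteq> 0" "q - c \<noteq> 0" "p + c \<noteq> 0" "q + c \<noteq> 0"
    using prods nz l by auto
  have split: "exp (a * t) * growth (r - a) t = (exp (r * t) - exp (a * t)) / (r - a)" if "r - a \<noteq> 0" for r a
    using that by (simp add: growth_def exp_diff field_simps)
  define k where "k = 2 * c / R"
  define P where "P = exp (p * t)"
  define Q where "Q = exp (q * t)"
  define A where "A = exp (c * t)"
  define B where "B = exp (- (c * t))"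
  define i1 where "i1 = 1 / (p - c)"
  define i2 where "i2 = 1 / (q - c)"
  define i3 where "i3 = 1 / (p + c)"
  define i4 where "i4 = 1 / (q + c)"
  have g: "A * growth (p - c) t = (P - A) * i1" "A * growth (q - c) t = (Q - A) * i2"
    "B * growth (p + c) t = (P - B) * i3" "B * growth (q + c) t = (Q - B) * i4"
    using split[of p c] split[of q c] split[of p "- c"] split[of q "- c"] nz'
    by (simp_all add: P_def Q_def A_def B_def i1_def i2_def i3_def i4_def)
  have damped: "damped_integral c l c t = k * (growth (p - c) t - growth (q - c) t)"
    "damped_integral c l (- c) t = k * (growth (p + c) t - growth (q + c) t)"
    by (simp_all add: damped_integral_def rate_plus_def rate_minus_def R_def p_def q_def k_def)
  define f where "f = l / 4 * k"
  have f: "f = l * c / (2 * R)" by (simp add: f_def k_def)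
  have i: "i1 - i3 = - (16 * c / (l * (3 * R - 5 * l)))" "i2 - i4 = 16 * c / (l * (5 * l + 3 * R))"
    "i1 - i2 = - R / (l * (l + 3 * c))" "i3 - i4 = - R / (l * (l - 3 * c))"
  proof -
    have "i1 - i3 = 2 * c / ((p - c) * (p + c))" "i2 - i4 = 2 * c / ((q - c) * (q + c))"
      "i1 - i2 = (q - p) / ((p - c) * (q - c))" "i3 - i4 = (q - p) / ((p + c) * (q + c))"
      unfolding i1_def i2_def i3_def i4_def using nz' by (simp_all add: diff_frac_eq)
    moreover have "q - p = - R / 2" by (simp add: p_def q_def field_simps)
    ultimately show "i1 - i3 = - (16 * c / (l * (3 * R - 5 * l)))" "i2 - i4 = 16 * c / (l * (5 * l + 3 * R))"
      "i1 - i2 = - R / (l * (l + 3 * c))" "i3 - i4 = - R / (l * (l - 3 * c))"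
      unfolding prods by simp_all
  qed
  \<comment> \<open>The coefficients of \<open>P\<close>, \<open>Q\<close>, \<open>A\<close> and
    \<open>B\<close>, in this order; the summands \<open>1 / 2\<close> come from
    \<open>cosh (c * t)\<close>.\<close>
  have coeffs: "- f * (i1 - i3) = 8 * c\<^sup>2 / R / (3 * R - 5 * l)"
    "f * (i2 - i4) = 8 * c\<^sup>2 / R / (3 * R + 5 * l)"
    "1 / 2 + f * (i1 - i2) = (l + 2 * c) / (2 * (l + 3 * c))"
    "1 / 2 - f * (i3 - i4) = (l - 2 * c) / (2 * (l - 3 * c))"
    subgoal using nz(1) l R(1) unfolding f i by (simp add: power2_eq_square)
    subgoal using nz(2) l R(1) unfolding f i by (simp add: power2_eq_square add.commute)
    subgoal using nz(4) l R(1) unfolding f i by (simp add: divide_simps) (simp add: algebra_simps)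
    subgoal using nz(3) l R(1) unfolding f i by (simp add: divide_simps) (simp add: algebra_simps)
    done
  have exps: "P = exp (- (3 / 4) * l * t) * exp (t / 4 * R)" "Q = exp (- (3 / 4) * l * t) * exp (- (t / 4) * R)"
    unfolding P_def Q_def exp_add[symmetric]
    by (rule arg_cong[of _ _ exp], simp add: p_def q_def field_simps)+
  have "mean_x c l t = (A + B) / 2 - l / 4 * (A * (k * (growth (p - c) t - growth (q - c) t))
      - B * (k * (growth (p + c) t - growth (q + c) t)))"
    unfolding mean_x_def damped by (simp only: A_def B_def cosh_field_def)
  also have "\<dots> = A / 2 + B / 2 - f * ((A * growth (p - c) t - A * growth (q - c) t)
      - (B * growth (p + c) t - B * growth (q + c) t))"
    by (simp add: f_def algebra_simps add_divide_distrib)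
  also have "\<dots> = - f * (i1 - i3) * P + f * (i2 - i4) * Q
     + (1 / 2 + f * (i1 - i2)) * A + (1 / 2 - f * (i3 - i4)) * B"
    unfolding g by (simp add: algebra_simps)
  finally show ?thesis
    unfolding coeffs R_def[symmetric] exps A_def B_def by (simp add: distrib_left mult.assoc)
qed

end

text \<open>Continuity includes the resonant rate, because \<open>growth\<close> is continuous in
  its rate at 0 as well. This identifies the limit for \<open>l = 3 * c\<close>.\<close>

lemma isCont_mean_x:
  assumes "0 < c" "0 < l"
  shows "isCont (\<lambda>l. mean_x c l t) l"
proof -
  have growth: "isCont (\<lambda>l. growth (f l) t) l" if "isCont f l" for f
    using isCont_o2[OF that, of "\<lambda>p. growth p t"] isCont_growth by simp
  have "isCont (\<lambda>l. damped_integral c l a t) l" for a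
    unfolding damped_integral_def rate_plus_def rate_minus_def
    using discriminant_pos[OF assms] by (intro continuous_intros growth) auto
  then show ?thesis
    unfolding mean_x_def by (intro continuous_intros) simp_all
qed

subsection \<open>Delaying the events to a grid\<close>

text \<open>
  One cell of length \<open>h\<close>: the hyperbolic flow over the cell, with the \<open>d\<close> events that occur in it
  moved to its right end. At an event the moving particle keeps half of its mass \<open>y\<close> and its
  direction becomes orthogonal, whence the factors \<open>(1 / 2) ^ d\<close> and \<open>0 ^ d\<close>.
\<close>
fun cell_step :: "real \<Rightarrow> real \<Rightarrow> nat \<Rightarrow> real \<times> real \<times> real \<times> real \<Rightarrow> real \<times> real \<times> real \<times> real" where
  "cell_step c h d (x, w, y, z) =
     (cosh (c * h) * x + sinh (c * h) * w,
      cosh (c * h) * w + sinh (c * h) * x - (1 - 0 ^ d) / 2 * (cosh (c * h) * z + sinh (c * h) * y),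
      (1 / 2) ^ d * (cosh (c * h) * y + sinh (c * h) * z),
      0 ^ d * (cosh (c * h) * z + sinh (c * h) * y))"

primrec cell_state :: "real \<Rightarrow> real \<Rightarrow> (nat \<Rightarrow> nat) \<Rightarrow> nat \<Rightarrow> real \<times> real \<times> real \<times> real" where
  "cell_state c h d 0 = (1, 0, 1, 0)"
| "cell_state c h d (Suc i) = cell_step c h (d i) (cell_state c h d i)"

definition "cell_x c h d i = fst (cell_state c h d i)"
definition "cell_w c h d i = fst (snd (cell_state c h d i))"
definition "cell_y c h d i = fst (snd (snd (cell_state c h d i)))"
definition "cell_z c h d i = snd (snd (snd (cell_state c h d i)))"

lemma cell_simps:
  "cell_x c h d 0 = 1" "cell_w c h d 0 = 0" "cell_y c h d 0 = 1" "cell_z c h d 0 = 0"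
  "cell_x c h d (Suc i) = cosh (c * h) * cell_x c h d i + sinh (c * h) * cell_w c h d i"
  "cell_w c h d (Suc i) = cosh (c * h) * cell_w c h d i + sinh (c * h) * cell_x c h d i
     - (1 - 0 ^ d i) / 2 * (cosh (c * h) * cell_z c h d i + sinh (c * h) * cell_y c h d i)"
  "cell_y c h d (Suc i) = (1 / 2) ^ d i * (cosh (c * h) * cell_y c h d i + sinh (c * h) * cell_z c h d i)"
  "cell_z c h d (Suc i) = 0 ^ d i * (cosh (c * h) * cell_z c h d i + sinh (c * h) * cell_y c h d i)"
  by (cases "cell_state c h d i"; simp add: cell_x_def cell_w_def cell_y_def cell_z_def)+

text \<open>Prepares independence: the state at the start of cell \<open>i\<close> cannot see the
  increment in that cell.\<close>

lemma cell_state_cong: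
  assumes "\<And>j. j < i \<Longrightarrow> d j = d' j"
  shows "cell_state c h d i = cell_state c h d' i"
  using assms by (induction i) auto

text \<open>The bound on \<open>x\<close> yields the dominating constant; the ordering of the
  components is the invariant that carries it. Since \<open>w\<close> is at most \<open>x\<close>,
  the flow multiplies \<open>x\<close> by at most \<open>exp (c * h)\<close>. At an event
  \<open>w\<close> loses only half of \<open>z\<close>, so it stays above the new value 0 of
  \<open>z\<close>.\<close>

lemma cell_bounds:
  assumes "0 \<le> c" "0 \<le> h"
  shows "0 \<le> cell_z c h d i \<and> cell_z c h d i \<le> cell_y c h d i \<and> cell_z c h d i \<le> cell_w c h d i \<and>
    cell_y c h d i \<le> cell_x c h d i \<and> cell_w c h d i \<le> cell_x c h d i \<and>
    cell_x c h d i \<le> exp (c * (i * h))"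
proof (induction i)
  case (Suc i)
  define C where "C = cosh (c * h)"
  define S where "S = sinh (c * h)"
  define x w y z where xwyz: "x = cell_x c h d i" "w = cell_w c h d i" "y = cell_y c h d i" "z = cell_z c h d i"
  have CS: "0 \<le> S" "S \<le> C" "0 \<le> C" "C + S = exp (c * h)"
    using assms sinh_less_cosh_real[of "c * h"] by (auto simp: C_def S_def cosh_plus_sinh)
  have IH: "0 \<le> z" "z \<le> y" "z \<le> w" "y \<le> x" "w \<le> x" "x \<le> exp (c * (i * h))"
    using Suc xwyz by auto
  have nonneg: "0 \<le> C * z" "0 \<le> S * z" "0 \<le> S * y" "0 \<le> C * y"
    using CS IH by auto
  have mono: "C * z \<le> C * w" "C * z \<le> C * y" "C * y \<le> C * x" "S * z \<le> S * w" "S * y \<le> S * x" "S * z \<le> S * y"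
    using CS IH by (auto intro!: mult_left_mono)
  have diffs: "S * (x - w) \<le> C * (x - w)" "S * (y - z) \<le> C * (y - z)"
    using CS IH by (auto intro!: mult_right_mono)
  have "C * x + S * w \<le> C * x + S * x"
    using CS IH by (intro add_left_mono mult_left_mono) auto
  also have "\<dots> = exp (c * h) * x" by (simp add: CS(4)[symmetric] algebra_simps)
  also have "\<dots> \<le> exp (c * h) * exp (c * (i * h))"
    using IH by (intro mult_left_mono) auto
  also have "\<dots> = exp (c * (Suc i * h))" by (simp add: exp_add[symmetric] algebra_simps)
  finally have x: "C * x + S * w \<le> exp (c * (Suc i * h))" .
  show ?case
  proof (cases "d i = 0")
    case True
    then show ?thesis
      using x nonneg mono diffs unfolding cell_simps C_def[symmetric] S_def[symmetric] xwyz[symmetric]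
      by (simp add: algebra_simps)
  next
    case False
    then have zero: "(0 :: real) ^ d i = 0" by simp
    have "(1 / 2) ^ d i * (C * y + S * z) \<le> 1 * (C * y + S * z)"
      using nonneg by (intro mult_right_mono) (auto intro: power_le_one)
    moreover have "0 \<le> (1 / 2) ^ d i * (C * y + S * z)"
      using nonneg by simp
    ultimately show ?thesis
      using x nonneg mono diffs unfolding cell_simps zero C_def[symmetric] S_def[symmetric] xwyz[symmetric]
      by (simp add: algebra_simps)
  qed
qed (simp add: cell_simps)

section \<open>Particle sums with delayed event times\<close>

definition cosh_prod :: "real \<Rightarrow> (nat \<Rightarrow> real) \<Rightarrow> nat \<Rightarrow> real" where
  "cosh_prod c S k = (\<Prod>j=1..k. cosh (c * (S j - S (j - 1))))"

lemma cosh_prod_simps [simp]: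
  "cosh_prod c S 0 = 1"
  "cosh_prod c S (Suc k) = cosh_prod c S k * cosh (c * (S (Suc k) - S k))"
  by (simp_all add: cosh_prod_def)

text \<open>Here \<open>n i\<close> counts the events up to grid point \<open>i * h\<close>, and
  \<open>S k\<close> is the delayed time of event \<open>k\<close>. The flow over a cell is the
  addition theorem for \<open>cosh\<close> and \<open>sinh\<close>; the jump is a regrouping of
  masses.\<close>

lemma cell_state_closed_form:
  fixes n :: "nat \<Rightarrow> nat" and S :: "nat \<Rightarrow> real" and c h :: real
  assumes n0: "n 0 = 0" and S0: "S 0 = 0" and n: "\<And>i. n (Suc i) = n i + d i"
    and S: "\<And>i k. n i < k \<Longrightarrow> k \<le> n (Suc i) \<Longrightarrow> S k = Suc i * h"
  defines "P \<equiv> \<lambda>T k. cosh (c * (T - S k)) * cosh_prod c S k"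
    and "Q \<equiv> \<lambda>T k. sinh (c * (T - S k)) * cosh_prod c S k"
  shows "cell_x c h d i = (\<Sum>k<n i. P (i * h) k / 2 ^ (k + 1)) + P (i * h) (n i) / 2 ^ n i \<and>
    cell_w c h d i = (\<Sum>k<n i. Q (i * h) k / 2 ^ (k + 1)) + Q (i * h) (n i) / 2 ^ n i \<and>
    cell_y c h d i = P (i * h) (n i) / 2 ^ n i \<and>
    cell_z c h d i = Q (i * h) (n i) / 2 ^ n i"
proof (induction i)
  case 0
  show ?case by (simp add: cell_simps n0 S0 P_def Q_def)
next
  case (Suc i)
  define T where "T = Suc i * h"
  have T: "T = i * h + h" by (simp add: T_def algebra_simps)
  have flowP: "P T k = cosh (c * h) * P (i * h) k + sinh (c * h) * Q (i * h) k" for k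
  proof -
    have "c * (T - S k) = c * h + c * (i * h - S k)" by (simp add: T algebra_simps)
    then show ?thesis unfolding P_def Q_def by (simp only: cosh_add) (simp add: algebra_simps)
  qed
  have flowQ: "Q T k = cosh (c * h) * Q (i * h) k + sinh (c * h) * P (i * h) k" for k
  proof -
    have "c * (T - S k) = c * h + c * (i * h - S k)" by (simp add: T algebra_simps)
    then show ?thesis unfolding P_def Q_def by (simp only: sinh_add) (simp add: algebra_simps)
  qed
  have ST: "S (n i + Suc j) = T" if "j < d i" for j
    using that S[of i "n i + Suc j"] by (simp add: n T_def)
  \<comment> \<open>An event at \<open>T\<close> moves the factor of the current flight into the
    product, and the new flight starts with \<open>cosh 0 = 1\<close>.\<close>
  have P: "P T (n i + j) = P T (n i)" if "j \<le> d i" for j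
    using that
  proof (induction j)
    case (Suc j)
    then show ?case using ST[of j] by (simp add: P_def mult.commute)
  qed simp
  have Q: "Q T (n i + Suc j) = 0" if "j < d i" for j
    using ST[OF that] by (simp add: Q_def)
  \<comment> \<open>Particles split off at \<open>T\<close> share one hyperbolic cosine, so the
    split redistributes mass without changing the sum.\<close>
  have sumP: "(\<Sum>k<n i + j. P T k / 2 ^ (k + 1)) + P T (n i) / 2 ^ (n i + j) =
      (\<Sum>k<n i. P T k / 2 ^ (k + 1)) + P T (n i) / 2 ^ n i" if "j \<le> d i" for j
    using that
  proof (induction j)
    case (Suc j)
    then show ?case using P[of j] by (simp add: field_simps)
  qed simp
  \<comment> \<open>Only the particle moving before \<open>T\<close> contributes, with half its
    mass, since the later ones have \<open>sinh 0 = 0\<close>. Hence any positive number of events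
    in a cell acts on \<open>w\<close> in the same way.\<close>
  have sumQ: "(\<Sum>k<n i + Suc j. Q T k / 2 ^ (k + 1)) =
      (\<Sum>k<n i. Q T k / 2 ^ (k + 1)) + Q T (n i) / 2 ^ n i / 2" if "j < d i" for j
    using that
  proof (induction j)
    case (Suc j)
    then show ?case using Q[of j] by simp
  qed simp
  have flow_sumP: "(\<Sum>k<m. P T k / 2 ^ (k + 1)) = cosh (c * h) * (\<Sum>k<m. P (i * h) k / 2 ^ (k + 1))
      + sinh (c * h) * (\<Sum>k<m. Q (i * h) k / 2 ^ (k + 1))" for m
    by (simp add: flowP sum_distrib_left sum.distrib[symmetric] add_divide_distrib)
  have flow_sumQ: "(\<Sum>k<m. Q T k / 2 ^ (k + 1)) = cosh (c * h) * (\<Sum>k<m. Q (i * h) k / 2 ^ (k + 1))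
      + sinh (c * h) * (\<Sum>k<m. P (i * h) k / 2 ^ (k + 1))" for m
    by (simp add: flowQ sum_distrib_left sum.distrib[symmetric] add_divide_distrib)
  note IH = Suc.IH[THEN conjunct1] Suc.IH[THEN conjunct2, THEN conjunct1]
    Suc.IH[THEN conjunct2, THEN conjunct2, THEN conjunct1] Suc.IH[THEN conjunct2, THEN conjunct2, THEN conjunct2]
  have x: "cell_x c h d (Suc i) = (\<Sum>k<n i. P T k / 2 ^ (k + 1)) + P T (n i) / 2 ^ n i"
    unfolding cell_simps IH flow_sumP unfolding flowP by (simp add: algebra_simps add_divide_distrib)
  have w: "cell_w c h d (Suc i) = (\<Sum>k<n i. Q T k / 2 ^ (k + 1)) + Q T (n i) / 2 ^ n i
      - (1 - 0 ^ d i) / 2 * (Q T (n i) / 2 ^ n i)"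
    unfolding cell_simps IH flow_sumQ unfolding flowQ by (simp add: distrib_left add_divide_distrib)
  have y: "cell_y c h d (Suc i) = (1 / 2) ^ d i * (P T (n i) / 2 ^ n i)"
    unfolding cell_simps IH flowP by (simp add: add_divide_distrib)
  have z: "cell_z c h d (Suc i) = 0 ^ d i * (Q T (n i) / 2 ^ n i)"
    unfolding cell_simps IH flowQ by (simp add: add_divide_distrib)
  have yz: "cell_y c h d (Suc i) = P T (n (Suc i)) / 2 ^ n (Suc i)"
    "cell_z c h d (Suc i) = Q T (n (Suc i)) / 2 ^ n (Suc i)"
    using P[of "d i"] Q[of "d i - 1"] unfolding y z n
    by (cases "d i"; simp add: power_add power_divide)+
  have "cell_x c h d (Suc i) = (\<Sum>k<n (Suc i). P T k / 2 ^ (k + 1)) + P T (n (Suc i)) / 2 ^ n (Suc i)"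
    unfolding x n using sumP[of "d i"] P[of "d i"] by simp
  moreover have "cell_w c h d (Suc i) = (\<Sum>k<n (Suc i). Q T k / 2 ^ (k + 1)) + Q T (n (Suc i)) / 2 ^ n (Suc i)"
    unfolding w n using sumQ[of "d i - 1"] Q[of "d i - 1"] by (cases "d i") simp_all
  ultimately show ?case
    using yz by (simp add: T_def)
qed

section \<open>Event times of a path and convergence of the delayed state\<close>

lemma event_time_le:
  assumes "0 \<le> s" "k \<le> n s"
  shows "event_time n k \<le> s"
  unfolding event_time_def using assms by (intro cInf_lower bdd_belowI[of _ 0]) auto

text \<open>The infimum is attained: the set has members arbitrarily close to it, and by right
  continuity the path is constant just to its right.\<close>

lemma le_at_event_time:
  fixes n :: "real \<Rightarrow> nat"
  assumes right_cont: "\<And>s. 0 \<le> s \<Longrightarrow> eventually (\<lambda>u. n u = n s) (at_right s)"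
    and s: "0 \<le> s" "k \<le> n s"
  shows "0 \<le> event_time n k" "k \<le> n (event_time n k)"
proof -
  let ?A = "{s. 0 \<le> s \<and> k \<le> n s}"
  let ?I = "event_time n k"
  have ne: "?A \<noteq> {}" using s by auto
  show "0 \<le> ?I"
    unfolding event_time_def using ne by (intro cInf_greatest) auto
  then obtain b where b: "?I < b" "\<And>u. ?I < u \<Longrightarrow> u < b \<Longrightarrow> n u = n ?I"
    using right_cont[of ?I] unfolding eventually_at_right_field by blast
  have "\<exists>u\<in>?A. u < b"
    using b(1) ne unfolding event_time_def
    by (subst (asm) cInf_less_iff) (auto intro!: bdd_belowI[of _ 0])
  then obtain u where u: "0 \<le> u" "k \<le> n u" "u < b" by auto
  have "?I \<le> u" using event_time_le[of u k n] u by simp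
  then show "k \<le> n ?I"
    using b(2)[of u] u by (cases "u = ?I") auto
qed

text \<open>Rounding up to a multiple of the mesh moves a point by at most one mesh width.\<close>

lemma grid_ceiling_tendsto:
  fixes s t :: real
  assumes "0 < t"
  shows "(\<lambda>m. t / real m * \<lceil>s / (t / real m)\<rceil>) \<longlonglongrightarrow> s"
proof -
  have bound: "norm (t / real m * \<lceil>s / (t / real m)\<rceil> - s) \<le> t / m" if "0 < m" for m
  proof -
    define h where "h = t / m"
    have h: "0 < h" using assms that by (simp add: h_def)
    have "\<bar>\<lceil>s / h\<rceil> - s / h\<bar> \<le> 1"
      using ceiling_correct[of "s / h"] by linarith
    then have "h * \<bar>\<lceil>s / h\<rceil> - s / h\<bar> \<le> h * 1"
      using h by (intro mult_left_mono) auto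
    moreover have "h * \<bar>\<lceil>s / h\<rceil> - s / h\<bar> = \<bar>h * (\<lceil>s / h\<rceil> - s / h)\<bar>"
      using h by (simp add: abs_mult)
    ultimately show ?thesis
      using h by (simp add: h_def[symmetric] right_diff_distrib)
  qed
  have "(\<lambda>m. t / real m * \<lceil>s / (t / real m)\<rceil> - s) \<longlonglongrightarrow> 0"
    by (rule Lim_null_comparison[OF eventually_mono[OF eventually_gt_at_top[of 0] bound]
          lim_const_over_n])
  then show ?thesis by (simp add: LIM_zero_iff)
qed

text \<open>For a fixed path the number of particles at time \<open>t\<close> is fixed, so the
  delayed value is a finite sum depending continuously on the delayed event times, which
  converge.\<close>

lemma cell_x_tendsto_center_of_mass:
  fixes n :: "real \<Rightarrow> nat"
  assumes t: "0 < t" and n0: "n 0 = 0"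
    and mono: "\<And>s u. 0 \<le> s \<Longrightarrow> s \<le> u \<Longrightarrow> n s \<le> n u"
    and right_cont: "\<And>s. 0 \<le> s \<Longrightarrow> eventually (\<lambda>u. n u = n s) (at_right s)"
  shows "(\<lambda>m. cell_x c (t / m) (\<lambda>i. n (Suc i * (t / m)) - n (i * (t / m))) m)
    \<longlonglongrightarrow> cosh (center_of_mass_distance c n t)"
proof -
  define S where "S m k = t / real m * \<lceil>event_time n k / (t / real m)\<rceil>" for m k
  have lim: "(\<lambda>m. S m k) \<longlonglongrightarrow> event_time n k" for k
    unfolding S_def by (rule grid_ceiling_tendsto[OF t])
  have eq: "cell_x c (t / m) (\<lambda>i. n (Suc i * (t / m)) - n (i * (t / m))) m =
      (\<Sum>k<n t. cosh (c * (t - S m k)) * cosh_prod c (S m) k / 2 ^ (k + 1))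
      + cosh (c * (t - S m (n t))) * cosh_prod c (S m) (n t) / 2 ^ n t" if m: "0 < m" for m :: nat
  proof -
    define h where "h = t / m"
    have h: "0 < h" "m * h = t" using t m by (simp_all add: h_def)
    have le: "n (i * h) \<le> n (Suc i * h)" for i :: nat
      using h by (intro mono) (auto intro!: mult_right_mono)
    \<comment> \<open>Event \<open>k\<close> lies in \<open>(i * h, Suc i * h]\<close>, strictly
      after the left end because the path is still below \<open>k\<close> there. Rounding up
      therefore gives the right end.\<close>
    have S: "S m k = Suc i * h" if k: "n (i * h) < k" "k \<le> n (Suc i * h)" for i k :: nat
    proof -
      have ev: "0 \<le> event_time n k" "k \<le> n (event_time n k)"
        using le_at_event_time[OF right_cont _ k(2)] h by auto
      have "event_time n k \<le> Suc i * h"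
        using event_time_le[of "Suc i * h" k n] k(2) h by simp
      moreover have "i * h < event_time n k"
      proof (rule ccontr)
        assume "\<not> i * h < event_time n k"
        then have "n (event_time n k) \<le> n (i * h)"
          using ev by (intro mono) auto
        then show False using ev k by simp
      qed
      ultimately have "\<lceil>event_time n k / h\<rceil> = int (Suc i)"
        using h by (intro ceiling_unique) (simp_all add: field_simps)
      then show ?thesis by (simp add: S_def h_def[symmetric])
    qed
    have "S m 0 = 0" by (simp add: S_def event_time_0)
    from cell_state_closed_form[of "\<lambda>i. n (i * h)" "S m" "\<lambda>i. n (Suc i * h) - n (i * h)" h c m,
        OF _ this _ S] n0 le
    show ?thesis
      by (simp only: h_def[symmetric] h(2)) (simp add: algebra_simps)
  qed
  have "(\<lambda>m. (\<Sum>k<n t. cosh (c * (t - S m k)) * cosh_prod c (S m) k / 2 ^ (k + 1))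
      + cosh (c * (t - S m (n t))) * cosh_prod c (S m) (n t) / 2 ^ n t) \<longlonglongrightarrow>
      (\<Sum>k<n t. cosh (c * (t - event_time n k)) * cosh_prod c (event_time n) k / 2 ^ (k + 1))
      + cosh (c * (t - event_time n (n t))) * cosh_prod c (event_time n) (n t) / 2 ^ n t"
    unfolding cosh_prod_def by (intro tendsto_intros lim) auto
  also have "(\<Sum>k<n t. cosh (c * (t - event_time n k)) * cosh_prod c (event_time n) k / 2 ^ (k + 1))
      + cosh (c * (t - event_time n (n t))) * cosh_prod c (event_time n) (n t) / 2 ^ n t =
      cosh (center_of_mass_distance c n t)"
    by (simp add: center_of_mass_distance(2) particle_distance(2) cosh_prod_def)
  finally show ?thesis
    by (rule Lim_transform_eventually)
      (intro eventually_mono[OF eventually_gt_at_top[of 0]] eq[symmetric])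
qed

subsection \<open>Means of the delayed state\<close>

text \<open>The probability generating function. The value \<open>a = 1 / 2\<close> serves the
  halving of \<open>y\<close>, and \<open>a = 0\<close> the reset of \<open>z\<close>, where
  \<open>0 ^ 0 = 1\<close> makes the mean the probability of no event.\<close>

lemma poisson_pmf_expectation_power:
  fixes a r :: real
  assumes "0 < r" "0 \<le> a" "a \<le> 1"
  shows "measure_pmf.expectation (poisson_pmf r) (\<lambda>k. a ^ k) = exp (- ((1 - a) * r))"
proof -
  have sums: "(\<lambda>k. exp (- r) * ((r * a) ^ k / fact k)) sums (exp (- r) * exp (r * a))"
    using exp_converges[of "r * a"] by (intro sums_mult) (simp add: divide_inverse mult.commute)
  have eq: "pmf (poisson_pmf r) k * a ^ k = exp (- r) * ((r * a) ^ k / fact k)" for k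
    using assms by (subst pmf_poisson) (simp_all add: power_mult_distrib)
  have nonneg: "0 \<le> exp (- r) * ((r * a) ^ k / fact k)" for k
    using assms by simp
  have "measure_pmf.expectation (poisson_pmf r) (\<lambda>k. a ^ k) =
      (\<integral>k. pmf (poisson_pmf r) k * a ^ k \<partial>count_space UNIV)"
    unfolding measure_pmf_eq_density by (subst integral_density) simp_all
  also have "\<dots> = (\<integral>k. exp (- r) * ((r * a) ^ k / fact k) \<partial>count_space UNIV)"
    by (simp only: eq)
  also have "\<dots> = (\<Sum>k. exp (- r) * ((r * a) ^ k / fact k))"
  proof (rule integral_count_space_nat)
    show "integrable (count_space UNIV) (\<lambda>k. exp (- r) * ((r * a) ^ k / fact k))"
      unfolding integrable_count_space_nat_iff real_norm_def abs_of_nonneg[OF nonneg]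
      using sums by (rule sums_summable)
  qed
  also have "\<dots> = exp (- ((1 - a) * r))"
    using sums by (simp add: sums_iff exp_add[symmetric] algebra_simps)
  finally show ?thesis .
qed

text \<open>The index set \<open>I\<close> stays fixed while \<open>i\<close> grows, which keeps the
  induction in one product space.\<close>

lemma measurable_cell:
  assumes "{..<i} \<subseteq> I"
  shows "(\<lambda>f. cell_x c h f i) \<in> borel_measurable (PiM I (\<lambda>_. count_space UNIV)) \<and>
    (\<lambda>f. cell_w c h f i) \<in> borel_measurable (PiM I (\<lambda>_. count_space UNIV)) \<and>
    (\<lambda>f. cell_y c h f i) \<in> borel_measurable (PiM I (\<lambda>_. count_space UNIV)) \<and>
    (\<lambda>f. cell_z c h f i) \<in> borel_measurable (PiM I (\<lambda>_. count_space UNIV))"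
  using assms
proof (induction i)
  case (Suc i)
  have pow [measurable]: "(\<lambda>f. a ^ f i) \<in> borel_measurable (PiM I (\<lambda>_. count_space UNIV))" for a :: real
    using Suc.prems by (intro measurable_compose[OF measurable_component_singleton]) auto
  have "{..<i} \<subseteq> I" using Suc.prems by auto
  note IH = Suc.IH[OF this]
  have [measurable]: "(\<lambda>f. cell_x c h f i) \<in> borel_measurable (PiM I (\<lambda>_. count_space UNIV))"
    "(\<lambda>f. cell_w c h f i) \<in> borel_measurable (PiM I (\<lambda>_. count_space UNIV))"
    "(\<lambda>f. cell_y c h f i) \<in> borel_measurable (PiM I (\<lambda>_. count_space UNIV))"
    "(\<lambda>f. cell_z c h f i) \<in> borel_measurable (PiM I (\<lambda>_. count_space UNIV))"
    using IH by blast+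
  show ?case unfolding cell_simps by (intro conjI) measurable
qed (simp add: cell_simps)

context poisson_process
begin

definition increment :: "real \<Rightarrow> nat \<Rightarrow> 'a \<Rightarrow> nat" where
  "increment h i \<omega> = N (real (Suc i) * h) \<omega> - N (real i * h) \<omega>"

lemma measurable_increment: "0 \<le> h \<Longrightarrow> increment h i \<in> measurable M (count_space UNIV)"
  unfolding increment_def[abs_def]
  using random_variable_N[of "real (Suc i) * h"] random_variable_N[of "real i * h"] by simp

lemma expectation_power_increment:
  assumes "0 < h" "0 \<le> a" "a \<le> 1"
  shows "expectation (\<lambda>\<omega>. a ^ increment h i \<omega>) = exp (- ((1 - a) * (rate * h)))"
proof -
  have "expectation (\<lambda>\<omega>. a ^ increment h i \<omega>) =
      integral\<^sup>L (distr M (count_space UNIV) (increment h i)) (\<lambda>k. a ^ k)"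
    using assms by (intro integral_distr[symmetric] measurable_increment) auto
  also have "distr M (count_space UNIV) (increment h i) = measure_pmf (poisson_pmf (rate * h))"
    using poisson_increments[of "real i * h" "real (Suc i) * h"] assms
    by (simp add: increment_def[abs_def] algebra_simps)
  finally show ?thesis
    using poisson_pmf_expectation_power[of "rate * h" a] assms rate_pos by simp
qed

text \<open>The power depends on cell \<open>i\<close> and \<open>F\<close> on earlier cells, so the
  mean factorises. The assumption \<open>past\<close> reconciles \<open>F\<close> on full sequences
  with measurability on the product over \<open>{..<i}\<close>.\<close>

lemma expectation_power_increment_mult:
  fixes F :: "(nat \<Rightarrow> nat) \<Rightarrow> real"
  assumes h: "0 < h" and a: "0 \<le> a" "a \<le> 1"
    and F: "F \<in> borel_measurable (PiM {..<i} (\<lambda>_. count_space UNIV))"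
    and past: "\<And>f. F (restrict f {..<i}) = F f"
    and bound: "\<And>f. \<bar>F f\<bar> \<le> B"
  shows "expectation (\<lambda>\<omega>. a ^ increment h i \<omega> * F (\<lambda>j. increment h j \<omega>)) =
    exp (- ((1 - a) * (rate * h))) * expectation (\<lambda>\<omega>. F (\<lambda>j. increment h j \<omega>))"
    and "integrable M (\<lambda>\<omega>. a ^ increment h i \<omega> * F (\<lambda>j. increment h j \<omega>))"
proof -
  have "indep_vars (\<lambda>_. count_space UNIV) (increment h) {..<Suc i}"
    unfolding increment_def[abs_def]
    using independent_increments[of "\<lambda>i. real i * h" "Suc i"] h by simp
  then have "indep_var (PiM {i} (\<lambda>_. count_space UNIV)) (\<lambda>\<omega>. restrict (\<lambda>j. increment h j \<omega>) {i})
      (PiM {..<i} (\<lambda>_. count_space UNIV)) (\<lambda>\<omega>. restrict (\<lambda>j. increment h j \<omega>) {..<i})"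
    by (rule indep_var_restrict) auto
  then have "indep_var borel ((\<lambda>f. a ^ f i) \<circ> (\<lambda>\<omega>. restrict (\<lambda>j. increment h j \<omega>) {i}))
      borel (F \<circ> (\<lambda>\<omega>. restrict (\<lambda>j. increment h j \<omega>) {..<i}))"
    by (rule indep_var_compose)
      (auto intro!: F measurable_compose[OF measurable_component_singleton])
  then have ind: "indep_var borel (\<lambda>\<omega>. a ^ increment h i \<omega>) borel (\<lambda>\<omega>. F (\<lambda>j. increment h j \<omega>))"
    by (simp add: comp_def past)
  have int1: "integrable M (\<lambda>\<omega>. a ^ increment h i \<omega>)"
    using a indep_var_rv1[OF ind] by (intro integrable_const_bound[of _ 1]) (auto intro: power_le_one)
  have int2: "integrable M (\<lambda>\<omega>. F (\<lambda>j. increment h j \<omega>))"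
    using bound indep_var_rv2[OF ind] by (intro integrable_const_bound[of _ B]) auto
  show "integrable M (\<lambda>\<omega>. a ^ increment h i \<omega> * F (\<lambda>j. increment h j \<omega>))"
    using ind int1 int2 by (rule indep_var_integrable)
  show "expectation (\<lambda>\<omega>. a ^ increment h i \<omega> * F (\<lambda>j. increment h j \<omega>)) =
    exp (- ((1 - a) * (rate * h))) * expectation (\<lambda>\<omega>. F (\<lambda>j. increment h j \<omega>))"
    using indep_var_lebesgue_integral[OF ind int1 int2] expectation_power_increment[OF h a] by simp
qed

text \<open>Each step is linear in the state, with coefficients built from powers
  \<open>a ^ d i\<close>; independence replaces these powers by their means. The result is the
  recursion assumed in \<open>splitting_scheme_tendsto\<close>.\<close>

lemma expectation_cell:
  assumes c: "0 \<le> c" and h: "0 < h"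
  defines "E \<equiv> \<lambda>u i. expectation (\<lambda>\<omega>. u c h (\<lambda>j. increment h j \<omega>) i)"
  shows "E cell_x 0 = 1" "E cell_w 0 = 0" "E cell_y 0 = 1" "E cell_z 0 = 0"
    and "E cell_x (Suc i) = cosh (c * h) * E cell_x i + sinh (c * h) * E cell_w i"
    and "E cell_w (Suc i) = cosh (c * h) * E cell_w i + sinh (c * h) * E cell_x i
      - (1 - exp (- (rate * h))) / 2 * (cosh (c * h) * E cell_z i + sinh (c * h) * E cell_y i)"
    and "E cell_y (Suc i) = exp (- (rate * h / 2)) * (cosh (c * h) * E cell_y i + sinh (c * h) * E cell_z i)"
    and "E cell_z (Suc i) = exp (- (rate * h)) * (cosh (c * h) * E cell_z i + sinh (c * h) * E cell_y i)"
proof -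
  let ?D = "\<lambda>\<omega> j. increment h j \<omega>"
  define C where "C = cosh (c * h)"
  define S where "S = sinh (c * h)"
  have CS: "0 \<le> C" "0 \<le> S" using c h by (simp_all add: C_def S_def)
  have restr: "cell_state c h (restrict f {..<i}) i = cell_state c h f i" for f i
    by (rule cell_state_cong) auto
  define e where "e i = exp (c * (real i * h))" for i
  have bounds: "\<bar>cell_x c h f i\<bar> \<le> e i" "\<bar>cell_w c h f i\<bar> \<le> e i" "\<bar>cell_y c h f i\<bar> \<le> e i" "\<bar>cell_z c h f i\<bar> \<le> e i" for f i
    using cell_bounds[of c h f i] c h by (auto simp: e_def)
  have bound2: "\<bar>C * a + S * b\<bar> \<le> C * B + S * B" if "\<bar>a\<bar> \<le> B" "\<bar>b\<bar> \<le> B" for a b B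
  proof -
    have "\<bar>C * a + S * b\<bar> \<le> C * \<bar>a\<bar> + S * \<bar>b\<bar>"
      using CS by (intro order.trans[OF abs_triangle_ineq]) (simp add: abs_mult)
    also have "\<dots> \<le> C * B + S * B"
      using CS that by (intro add_mono mult_left_mono) auto
    finally show ?thesis .
  qed
  note meas = measurable_cell[OF order.refl]
  have [measurable]:
    "(\<lambda>f. cell_x c h f i) \<in> borel_measurable (PiM {..<i} (\<lambda>_. count_space UNIV))"
    "(\<lambda>f. cell_w c h f i) \<in> borel_measurable (PiM {..<i} (\<lambda>_. count_space UNIV))"
    "(\<lambda>f. cell_y c h f i) \<in> borel_measurable (PiM {..<i} (\<lambda>_. count_space UNIV))"
    "(\<lambda>f. cell_z c h f i) \<in> borel_measurable (PiM {..<i} (\<lambda>_. count_space UNIV))" for i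
    using meas by blast+
  have comp: "cell_x c h (restrict f {..<i}) i = cell_x c h f i"
    "cell_w c h (restrict f {..<i}) i = cell_w c h f i"
    "cell_y c h (restrict f {..<i}) i = cell_y c h f i"
    "cell_z c h (restrict f {..<i}) i = cell_z c h f i" for f i
    by (simp_all only: cell_x_def cell_w_def cell_y_def cell_z_def restr)
  \<comment> \<open>Integrability is read off at \<open>a = 1\<close>, where the power is
    constant.\<close>
  have int: "integrable M (\<lambda>\<omega>. cell_x c h (?D \<omega>) i)" "integrable M (\<lambda>\<omega>. cell_w c h (?D \<omega>) i)"
    "integrable M (\<lambda>\<omega>. cell_y c h (?D \<omega>) i)" "integrable M (\<lambda>\<omega>. cell_z c h (?D \<omega>) i)" for i
    using expectation_power_increment_mult(2)[OF h, of 1 "\<lambda>f. cell_x c h f i" i "e i"]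
      expectation_power_increment_mult(2)[OF h, of 1 "\<lambda>f. cell_w c h f i" i "e i"]
      expectation_power_increment_mult(2)[OF h, of 1 "\<lambda>f. cell_y c h f i" i "e i"]
      expectation_power_increment_mult(2)[OF h, of 1 "\<lambda>f. cell_z c h f i" i "e i"]
    by (simp_all add: comp bounds)
  have jump_y: "expectation (\<lambda>\<omega>. a ^ increment h i \<omega> * (C * cell_y c h (?D \<omega>) i + S * cell_z c h (?D \<omega>) i)) =
      exp (- ((1 - a) * (rate * h))) * (C * E cell_y i + S * E cell_z i)" if "0 \<le> a" "a \<le> 1" for a
  proof -
    have "expectation (\<lambda>\<omega>. C * cell_y c h (?D \<omega>) i + S * cell_z c h (?D \<omega>) i) = C * E cell_y i + S * E cell_z i"
      using int by (simp add: E_def)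
    then show ?thesis
      using expectation_power_increment_mult(1)[OF h that, of "\<lambda>f. C * cell_y c h f i + S * cell_z c h f i" i
          "C * e i + S * e i"] by (simp add: comp bounds bound2)
  qed
  have jump_z: "expectation (\<lambda>\<omega>. a ^ increment h i \<omega> * (C * cell_z c h (?D \<omega>) i + S * cell_y c h (?D \<omega>) i)) =
      exp (- ((1 - a) * (rate * h))) * (C * E cell_z i + S * E cell_y i)"
    "integrable M (\<lambda>\<omega>. a ^ increment h i \<omega> * (C * cell_z c h (?D \<omega>) i + S * cell_y c h (?D \<omega>) i))"
    if "0 \<le> a" "a \<le> 1" for a
  proof -
    have "expectation (\<lambda>\<omega>. C * cell_z c h (?D \<omega>) i + S * cell_y c h (?D \<omega>) i) = C * E cell_z i + S * E cell_y i"
      using int by (simp add: E_def)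
    then show "expectation (\<lambda>\<omega>. a ^ increment h i \<omega> * (C * cell_z c h (?D \<omega>) i + S * cell_y c h (?D \<omega>) i)) =
      exp (- ((1 - a) * (rate * h))) * (C * E cell_z i + S * E cell_y i)"
      "integrable M (\<lambda>\<omega>. a ^ increment h i \<omega> * (C * cell_z c h (?D \<omega>) i + S * cell_y c h (?D \<omega>) i))"
      using expectation_power_increment_mult[OF h that, of "\<lambda>f. C * cell_z c h f i + S * cell_y c h f i" i
          "C * e i + S * e i"] by (simp_all add: comp bounds bound2)
  qed
  show "E cell_x 0 = 1" "E cell_w 0 = 0" "E cell_y 0 = 1" "E cell_z 0 = 0"
    by (simp_all add: E_def cell_simps prob_space)
  show "E cell_x (Suc i) = cosh (c * h) * E cell_x i + sinh (c * h) * E cell_w i"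
    using int by (simp add: E_def cell_simps)
  show "E cell_y (Suc i) = exp (- (rate * h / 2)) * (cosh (c * h) * E cell_y i + sinh (c * h) * E cell_z i)"
    using jump_y[of "1 / 2"] by (simp add: E_def cell_simps C_def S_def)
  show "E cell_z (Suc i) = exp (- (rate * h)) * (cosh (c * h) * E cell_z i + sinh (c * h) * E cell_y i)"
    using jump_z(1)[of 0] by (simp add: E_def cell_simps C_def S_def)
  \<comment> \<open>Writing \<open>1 - 0 ^ d i\<close> as \<open>1 ^ d i - 0 ^ d i\<close> brings
    both parts into the form of \<open>jump_z\<close>.\<close>
  have w: "cell_w c h d (Suc i) = C * cell_w c h d i + S * cell_x c h d i
      - 1 / 2 * (1 ^ d i * (C * cell_z c h d i + S * cell_y c h d i))
      + 1 / 2 * (0 ^ d i * (C * cell_z c h d i + S * cell_y c h d i))" for d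
    by (simp add: cell_simps C_def S_def algebra_simps diff_divide_distrib add_divide_distrib)
  have "E cell_w (Suc i) = C * E cell_w i + S * E cell_x i
      - 1 / 2 * (exp (- ((1 - 1) * (rate * h))) * (C * E cell_z i + S * E cell_y i))
      + 1 / 2 * (exp (- ((1 - 0) * (rate * h))) * (C * E cell_z i + S * E cell_y i))"
    unfolding jump_z(1)[of 1, simplified power_one, symmetric, OF zero_le_one order.refl] jump_z(1)[of 0, symmetric, OF order.refl zero_le_one]
    using int jump_z(2)[of 1] jump_z(2)[of 0] unfolding E_def w by simp
  then show "E cell_w (Suc i) = cosh (c * h) * E cell_w i + sinh (c * h) * E cell_x i
      - (1 - exp (- (rate * h))) / 2 * (cosh (c * h) * E cell_z i + sinh (c * h) * E cell_y i)"
    unfolding C_def[symmetric] S_def[symmetric] by (simp add: algebra_simps diff_divide_distrib add_divide_distrib)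
qed

end

section \<open>Passage to the limit and the resonant rate\<close>

lemma (in poisson_process) measurable_cell_x_increment:
  assumes "0 \<le> h"
  shows "(\<lambda>\<omega>. cell_x c h (\<lambda>j. increment h j \<omega>) i) \<in> borel_measurable M"
proof -
  have "(\<lambda>\<omega>. cell_x c h (restrict (\<lambda>j. increment h j \<omega>) {..<i}) i) \<in> borel_measurable M"
    using measurable_cell[of i "{..<i}" c h] measurable_increment[OF assms]
    by (intro measurable_compose[OF measurable_restrict[of "{..<i}"]]) auto
  moreover have "cell_x c h (restrict f {..<i}) i = cell_x c h f i" for f
    unfolding cell_x_def by (rule arg_cong[OF cell_state_cong]) auto
  ultimately show ?thesis by simp
qed

text \<open>The means of the delayed values have two limits, one by dominated convergence and one by
  the one-step scheme; uniqueness equates them.\<close>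

lemma (in poisson_process) expectation_center_of_mass:
  assumes c: "0 < c" and t: "0 < t"
  shows "integrable M (\<lambda>\<omega>. cosh (center_of_mass_distance c (\<lambda>s. N s \<omega>) t))"
    and "expectation (\<lambda>\<omega>. cosh (center_of_mass_distance c (\<lambda>s. N s \<omega>) t)) = mean_x c rate t"
proof -
  define X where "X \<omega> = cosh (center_of_mass_distance c (\<lambda>s. N s \<omega>) t)" for \<omega>
  define Y where "Y m \<omega> = cell_x c (t / real m) (\<lambda>j. increment (t / real m) j \<omega>) m" for m \<omega>
  have lim: "(\<lambda>m. Y m \<omega>) \<longlonglongrightarrow> X \<omega>" if "\<omega> \<in> space M" for \<omega>
    unfolding X_def Y_def increment_def
    using t N_0[OF that] N_mono[OF that] N_right_continuous[OF that]
    by (rule cell_x_tendsto_center_of_mass)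
  have measY: "Y m \<in> borel_measurable M" for m
    unfolding Y_def[abs_def] using t by (intro measurable_cell_x_increment) simp
  \<comment> \<open>Measurability is inherited from the approximations, each depending on finitely
    many values of the process.\<close>
  have measX: "X \<in> borel_measurable M"
    using lim measY by (rule borel_measurable_LIMSEQ_real)
  have bound: "norm (Y m \<omega>) \<le> exp (c * t)" for m \<omega>
  proof -
    \<comment> \<open>Only an inequality, because for \<open>m = 0\<close> the left side is
      0.\<close>
    have "c * (m * (t / m)) \<le> c * t" using c t by simp
    then have "exp (c * (m * (t / m))) \<le> exp (c * t)" by (simp only: exp_le_cancel_iff)
    moreover have "0 \<le> Y m \<omega>" "Y m \<omega> \<le> exp (c * (m * (t / m)))"
      using cell_bounds[of c "t / m" "\<lambda>j. increment (t / m) j \<omega>" m] c t unfolding Y_def by auto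
    ultimately show ?thesis by (simp only: real_norm_def abs_of_nonneg order.trans)
  qed
  have dom: "AE \<omega> in M. (\<lambda>m. Y m \<omega>) \<longlonglongrightarrow> X \<omega>" "\<And>m. AE \<omega> in M. norm (Y m \<omega>) \<le> exp (c * t)"
    "integrable M (\<lambda>_. exp (c * t))"
    using lim bound by auto
  show "integrable M (\<lambda>\<omega>. cosh (center_of_mass_distance c (\<lambda>s. N s \<omega>) t))"
    using integrable_dominated_convergence[OF measX measY dom(3,1,2)] by (simp add: X_def[abs_def])
  have "(\<lambda>m. expectation (Y m)) \<longlonglongrightarrow> expectation X"
    using integral_dominated_convergence[OF measX measY dom(3,1,2)] .
  moreover have "(\<lambda>m. expectation (Y m)) \<longlonglongrightarrow> mean_x c rate t"
    unfolding Y_def[abs_def]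
  proof (rule splitting_scheme_tendsto[where c = c and l = rate and
        x = "mean_x c rate" and w = "mean_w c rate" and y = "mean_y c rate" and z = "mean_z c rate" and
        X = "\<lambda>m i. expectation (\<lambda>\<omega>. cell_x c (t / real m) (\<lambda>j. increment (t / real m) j \<omega>) i)" and
        W = "\<lambda>m i. expectation (\<lambda>\<omega>. cell_w c (t / real m) (\<lambda>j. increment (t / real m) j \<omega>) i)" and
        Y = "\<lambda>m i. expectation (\<lambda>\<omega>. cell_y c (t / real m) (\<lambda>j. increment (t / real m) j \<omega>) i)" and
        Z = "\<lambda>m i. expectation (\<lambda>\<omega>. cell_z c (t / real m) (\<lambda>j. increment (t / real m) j \<omega>) i)"])
    show "0 \<le> c" "0 \<le> rate" "0 < t" using c t rate_pos by simp_all
    show "(mean_x c rate has_real_derivative c * mean_w c rate s) (at s)"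
      "(mean_w c rate has_real_derivative c * mean_x c rate s - rate / 2 * mean_z c rate s) (at s)"
      "(mean_y c rate has_real_derivative c * mean_z c rate s - rate / 2 * mean_y c rate s) (at s)"
      "(mean_z c rate has_real_derivative c * mean_y c rate s - rate * mean_z c rate s) (at s)" for s
      using DERIV_mean_x DERIV_mean_w DERIV_mean_y[OF c rate_pos] DERIV_mean_z[OF c rate_pos] by auto
  qed (use expectation_cell[of c] c t in \<open>auto simp: cell_simps(1-4) mean_init[OF c rate_pos] prob_space\<close>)
  ultimately show "expectation (\<lambda>\<omega>. cosh (center_of_mass_distance c (\<lambda>s. N s \<omega>) t)) = mean_x c rate t"
    using LIMSEQ_unique by (simp add: X_def[abs_def])
qed

text \<open>Integrability is part of the claim because the Bochner integral of a non-integrable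
  function is 0 by default. At the resonant rate the formula divides by zero, so the mean is stated
  as its limit over the punctured neighbourhood.\<close>

theorem theorem4p1:
  fixes M :: "'a measure" and N :: "real \<Rightarrow> 'a \<Rightarrow> nat" and c lambda t :: real
  assumes "0 < c" and "0 < lambda" and "poisson_process M lambda N" and "0 < t"
  shows "let X = (\<lambda>\<omega>. cosh (center_of_mass_distance c (\<lambda>s. N s \<omega>) t));
             F = (\<lambda>l. 2 ^ 3 * c\<^sup>2 * exp (- (3 / 4) * l * t) / sqrt (l\<^sup>2 + 16 * c\<^sup>2) *
                   (exp (- (t / 4) * sqrt (l\<^sup>2 + 16 * c\<^sup>2)) / (3 * sqrt (l\<^sup>2 + 16 * c\<^sup>2) + 5 * l)
                    + exp (t / 4 * sqrt (l\<^sup>2 + 16 * c\<^sup>2)) / (3 * sqrt (l\<^sup>2 + 16 * c\<^sup>2) - 5 * l))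
                 + (l + 2 * c) / (2 * (l + 3 * c)) * exp (c * t)
                 + (l - 2 * c) / (2 * (l - 3 * c)) * exp (- (c * t)))
         in integrable M X \<and>
            (lambda \<noteq> 3 * c \<longrightarrow> integral\<^sup>L M X = F lambda) \<and>
            (lambda = 3 * c \<longrightarrow> (F \<longlongrightarrow> integral\<^sup>L M X) (at (3 * c)))"
proof -
  interpret poisson_process M lambda N by fact
  define F where "F = (\<lambda>l. 2 ^ 3 * c\<^sup>2 * exp (- (3 / 4) * l * t) / sqrt (l\<^sup>2 + 16 * c\<^sup>2) *
                   (exp (- (t / 4) * sqrt (l\<^sup>2 + 16 * c\<^sup>2)) / (3 * sqrt (l\<^sup>2 + 16 * c\<^sup>2) + 5 * l)
                    + exp (t / 4 * sqrt (l\<^sup>2 + 16 * c\<^sup>2)) / (3 * sqrt (l\<^sup>2 + 16 * c\<^sup>2) - 5 * l))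
                 + (l + 2 * c) / (2 * (l + 3 * c)) * exp (c * t)
                 + (l - 2 * c) / (2 * (l - 3 * c)) * exp (- (c * t)))"
  have F: "F l = mean_x c l t" if "0 < l" "l \<noteq> 3 * c" for l
    unfolding F_def mean_x_closed_form[OF assms(1) that] ..
  have "F \<midarrow>3 * c\<rightarrow> mean_x c (3 * c) t"
  proof (rule Lim_transform_eventually)
    show "(\<lambda>l. mean_x c l t) \<midarrow>3 * c\<rightarrow> mean_x c (3 * c) t"
      using isCont_mean_x[of c "3 * c" t] assms(1) by (simp add: isCont_def)
    \<comment> \<open>The closed form is available for positive rates only, so the neighbourhood is
      cut down to these.\<close>
    have "eventually (\<lambda>l. l \<in> {0<..}) (nhds (3 * c))"
      using assms(1) by (intro eventually_nhds_in_open) auto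
    then show "eventually (\<lambda>l. mean_x c l t = F l) (at (3 * c))"
      unfolding eventually_at_filter by eventually_elim (auto simp: F)
  qed
  then show ?thesis
    unfolding Let_def F_def[symmetric]
    using expectation_center_of_mass[OF assms(1,4)] F[OF assms(2)] by simp
qed

end
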